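(* The Bondi--Metzner--Sachs group $\mathrm{BMS} = C^\infty(\mathbb{S}^2)\rtimes_\sigma \mathrm{SO}_{1,3}(\mathbb{R})_0$ is not locally exponential.
   Context: $\mathrm{SO}_{1,3}(\mathbb{R})_0$ is the identity component of the Lorentz group of $\mathbb{R}^{1,3}$ (quadratic form $x_0^2-\|x\|^2$). Write its elements in block form $g=\begin{pmatrix} a & b\\ c & m\end{pmatrix}$ with $a\in\mathbb{R}$, $b\in M_{1,3}(\mathbb{R})$, $c\in\mathbb{R}^3$, $m\in M_3(\mathbb{R})$. It acts on the unit sphere $\mathbb{S}^2\subseteq\mathbb{R}^3$ by $g.x=(a+bx)^{-1}(c+mx)$. The conformal factors $J_g(x):=(a+bx)^{-1}$, $x\in\mathbb{S}^2$, satisfy $J_{g_1g_2}(x)=J_{g_1}(g_2.x)J_{g_2}(x)$, and $(\sigma_{g^{-1}}f)(x):=J_g(x)f(g.x)$ defines a smooth left linear action $\sigma$ of $\mathrm{SO}_{1,3}(\mathbb{R})_0$ on the Fréchet space $C^\infty(\mathbb{S}^2)=C^\infty(\mathbb{S}^2,\mathbb{R})$ (with the $C^\infty$-topology of uniform convergence of all derivatives). For a Lie group $G$ acting smoothly and linearly on a locally convex space $E$ by $\sigma$, $E\rtimes_\sigma G$ is the Lie group on $E\times G$ with product $(v,g)(w,h)=(v+\sigma_g w,gh)$. Smoothness is in the sense of Bastiani: all iterated directional derivatives exist and are jointly continuous. An exponential function of a Lie group $H$ with Lie algebra $\mathbf{L}(H)$ is a smooth map $\exp:\mathbf{L}(H)\to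 H$ such that for each $x$, $t\mapsto\exp(tx)$ is a one-parameter group with derivative $x$ at $t=0$. $H$ is locally exponential if it has an exponential function which maps some open $0$-neighborhood in $\mathbf{L}(H)$ diffeomorphically onto an open neighborhood of the identity in $H$. *)

theory Defs
  imports "HOL-Analysis.Analysis" "HOL-Algebra.Group"
begin

section \<open>Locally convex spaces\<close>

class locally_convex_space = real_vector + t2_space + topological_ab_group_add +
  assumes tendsto_scaleR_Pair:
    "((\<lambda>p. fst p *\<^sub>R snd p) \<longlongrightarrow> r *\<^sub>R x) (nhds r \<times>\<^sub>F nhds x)"
  assumes locally_convex:
    "open U \<Longrightarrow> 0 \<in> U \<Longrightarrow> \<exists>V. open V \<and> 0 \<in> V \<and> V \<subseteq> U \<and>
      (\<forall>x\<in>V. \<forall>y\<in>V. \<forall>u\<ge>0. \<forall>v\<ge>0. u + v = 1 \<longrightarrow> u *\<^sub>R x + v *\<^sub>R y \<in> V)"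

instance real_normed_vector \<subseteq> locally_convex_space
proof
  fix r :: real and x :: 'a
  show "((\<lambda>p. fst p *\<^sub>R snd p) \<longlongrightarrow> r *\<^sub>R x) (nhds r \<times>\<^sub>F nhds x)"
    by (intro tendsto_scaleR filterlim_fst filterlim_snd)
next
  fix U :: "'a set"
  assume "open U" "0 \<in> U"
  then obtain e where "e > 0" "ball 0 e \<subseteq> U"
    by (meson open_contains_ball)
  then show "\<exists>V. open V \<and> 0 \<in> V \<and> V \<subseteq> U \<and>
      (\<forall>x\<in>V. \<forall>y\<in>V. \<forall>u\<ge>0. \<forall>v\<ge>0. u + v = 1 \<longrightarrow> u *\<^sub>R x + v *\<^sub>R y \<in> V)"
    unfolding convex_def[symmetric]
    by (intro exI[of _ "ball 0 e"]) auto
qed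

lemma tendsto_scaleR_lcs:
  fixes g :: "'c \<Rightarrow> 'a::locally_convex_space"
  assumes "(f \<longlongrightarrow> r) F" "(g \<longlongrightarrow> x) F"
  shows "((\<lambda>t. f t *\<^sub>R g t) \<longlongrightarrow> r *\<^sub>R x) F"
proof -
  have "filterlim (\<lambda>t. (f t, g t)) (nhds r \<times>\<^sub>F nhds x) F"
    using assms by (simp add: filterlim_Pair)
  from filterlim_compose[OF tendsto_scaleR_Pair this] show ?thesis
    by simp
qed

instance prod :: (topological_monoid_add, topological_monoid_add) topological_monoid_add
proof
  fix a b :: "'a \<times> 'b"
  have 1: "((\<lambda>x. fst x) \<longlongrightarrow> a) (nhds a \<times>\<^sub>F nhds b)"
    "((\<lambda>x. snd x) \<longlongrightarrow> b) (nhds a \<times>\<^sub>F nhds b)"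
    by (auto intro: filterlim_fst filterlim_snd)
  have "((\<lambda>x. (fst (fst x) + fst (snd x), snd (fst x) + snd (snd x)))
      \<longlongrightarrow> (fst a + fst b, snd a + snd b)) (nhds a \<times>\<^sub>F nhds b)"
    by (intro tendsto_Pair tendsto_add tendsto_fst tendsto_snd 1)
  then show "((\<lambda>x. fst x + snd x) \<longlongrightarrow> a + b) (nhds a \<times>\<^sub>F nhds b)"
    by (simp add: plus_prod_def)
qed

instance prod :: (topological_group_add, topological_group_add) topological_group_add
proof
  fix a :: "'a \<times> 'b"
  have "((\<lambda>x. (- fst x, - snd x)) \<longlongrightarrow> (- fst a, - snd a)) (nhds a)"
    by (intro tendsto_intros) (auto intro: filterlim_ident)
  then show "(uminus \<longlongrightarrow> - a) (nhds a)"
    by (simp add: uminus_prod_def[abs_def])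
qed

instance prod :: (topological_ab_group_add, topological_ab_group_add) topological_ab_group_add ..

instance prod :: (locally_convex_space, locally_convex_space) locally_convex_space
proof
  fix r :: real and x :: "'a \<times> 'b"
  have 1: "((\<lambda>x. fst x) \<longlongrightarrow> r) (nhds r \<times>\<^sub>F nhds x)"
    "((\<lambda>x. snd x) \<longlongrightarrow> x) (nhds r \<times>\<^sub>F nhds x)"
    by (auto intro: filterlim_fst filterlim_snd)
  have "((\<lambda>p. (fst p *\<^sub>R fst (snd p), fst p *\<^sub>R snd (snd p))) \<longlongrightarrow> (r *\<^sub>R fst x, r *\<^sub>R snd x))
      (nhds r \<times>\<^sub>F nhds x)"
    by (intro tendsto_Pair tendsto_scaleR_lcs tendsto_fst tendsto_snd 1)
  then show "((\<lambda>p. fst p *\<^sub>R snd p) \<longlongrightarrow> r *\<^sub>R x) (nhds r \<times>\<^sub>F nhds x)"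
    by (simp add: scaleR_prod_def)
next
  fix U :: "('a \<times> 'b) set"
  assume U: "open U" "0 \<in> U"
  then obtain A B where AB: "open A" "open B" "0 \<in> A" "0 \<in> B" "A \<times> B \<subseteq> U"
    by (metis open_prod_elim mem_Sigma_iff zero_prod_def)
  obtain A' where A': "open A'" "0 \<in> A'" "convex A'" "A' \<subseteq> A"
    using locally_convex[OF AB(1,3), folded convex_def] by blast
  obtain B' where B': "open B'" "0 \<in> B'" "convex B'" "B' \<subseteq> B"
    using locally_convex[OF AB(2,4), folded convex_def] by blast
  show "\<exists>V. open V \<and> 0 \<in> V \<and> V \<subseteq> U \<and>
      (\<forall>x\<in>V. \<forall>y\<in>V. \<forall>u\<ge>0. \<forall>v\<ge>0. u + v = 1 \<longrightarrow> u *\<^sub>R x + v *\<^sub>R y \<in> V)"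
    unfolding convex_def[symmetric]
    using A' B' AB(5)
    by (intro exI[of _ "A' \<times> B'"]) (auto simp: zero_prod_def intro!: open_Times convex_Times)
qed


section \<open>Bastiani smoothness\<close>

definition has_dir_deriv ::
    "('e::locally_convex_space \<Rightarrow> 'f::locally_convex_space) \<Rightarrow> 'f \<Rightarrow> 'e \<Rightarrow> 'e \<Rightarrow> bool" where
  "has_dir_deriv f l v x \<longleftrightarrow>
     ((\<lambda>t::real. (f (x + t *\<^sub>R v) - f x) /\<^sub>R t) \<longlongrightarrow> l) (at 0)"

definition dir_deriv ::
    "('e::locally_convex_space \<Rightarrow> 'f::locally_convex_space) \<Rightarrow> 'e \<Rightarrow> 'e \<Rightarrow> 'f" where
  "dir_deriv f v x = (THE l. has_dir_deriv f l v x)"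

fun iter_deriv ::
    "('e::locally_convex_space \<Rightarrow> 'f::locally_convex_space) \<Rightarrow> 'e list \<Rightarrow> 'e \<Rightarrow> 'f" where
  "iter_deriv f [] = f"
| "iter_deriv f (v # vs) = dir_deriv (iter_deriv f vs) v"

text \<open>The \<open>k\<close> directions of a \<open>k\<close>-th derivative are taken from a sequence \<open>w\<close>. Since only
  \<open>w 0, \<dots>, w (k - 1)\<close> occur, continuity in \<open>w\<close> for the product topology is the same as
  continuity in these \<open>k\<close> vectors.\<close>

definition smooth_on ::
    "'e::locally_convex_space set \<Rightarrow> ('e \<Rightarrow> 'f::locally_convex_space) \<Rightarrow> bool" where
  "smooth_on U f \<longleftrightarrow> open U \<and>
     (\<forall>vs v. \<forall>x\<in>U. \<exists>l. has_dir_deriv (iter_deriv f vs) l v x) \<and>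
     (\<forall>k. continuous_on (U \<times> UNIV)
        (\<lambda>(x, w :: nat \<Rightarrow> 'e). iter_deriv f (map w [0..<k]) x))"


subsection \<open>Closure properties of smooth maps\<close>

lemma has_dir_deriv_unique:
  assumes "has_dir_deriv f l v x" "has_dir_deriv f l' v x"
  shows "l = l'"
  using assms unfolding has_dir_deriv_def by (rule tendsto_unique[rotated]) simp

lemma dir_deriv_eqI: "has_dir_deriv f l v x \<Longrightarrow> dir_deriv f v x = l"
  unfolding dir_deriv_def by (blast intro: has_dir_deriv_unique)

lemma eventually_line_in:
  fixes x v :: "'e::locally_convex_space"
  assumes "open U" "x \<in> U"
  shows "eventually (\<lambda>t::real. x + t *\<^sub>R v \<in> U) (at 0)"
proof -
  have "((\<lambda>t::real. x + t *\<^sub>R v) \<longlongrightarrow> x + 0 *\<^sub>R v) (at 0)"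
    by (intro tendsto_add tendsto_scaleR_lcs tendsto_const tendsto_ident_at)
  from topological_tendstoD[OF this assms(1)] assms(2) show ?thesis
    by simp
qed

lemma has_dir_deriv_cong:
  assumes "open U" "x \<in> U" "\<And>y. y \<in> U \<Longrightarrow> f y = g y"
  shows "has_dir_deriv f l v x \<longleftrightarrow> has_dir_deriv g l v x"
  unfolding has_dir_deriv_def
proof (rule tendsto_cong)
  show "\<forall>\<^sub>F t in at 0. (f (x + t *\<^sub>R v) - f x) /\<^sub>R t = (g (x + t *\<^sub>R v) - g x) /\<^sub>R t"
    using eventually_line_in[OF assms(1,2)] by eventually_elim (use assms in auto)
qed

lemma dir_deriv_cong:
  assumes "open U" "x \<in> U" "\<And>y. y \<in> U \<Longrightarrow> f y = g y"
  shows "dir_deriv f v x = dir_deriv g v x"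
  unfolding dir_deriv_def using has_dir_deriv_cong[OF assms] by simp

lemma iter_deriv_cong:
  assumes "open U" "\<And>y. y \<in> U \<Longrightarrow> f y = g y"
  shows "x \<in> U \<Longrightarrow> iter_deriv f vs x = iter_deriv g vs x"
proof (induction vs arbitrary: x)
  case (Cons v vs)
  show ?case
    unfolding iter_deriv.simps by (rule dir_deriv_cong[OF assms(1)]) (use Cons in auto)
qed (use assms in auto)

lemma smooth_on_open: "smooth_on U f \<Longrightarrow> open U"
  by (simp add: smooth_on_def)

lemma smooth_on_has_dir_deriv:
  assumes "smooth_on U f" "x \<in> U"
  shows "has_dir_deriv (iter_deriv f vs) (iter_deriv f (v # vs) x) v x"
proof -
  obtain l where "has_dir_deriv (iter_deriv f vs) l v x"
    using assms unfolding smooth_on_def by blast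
  then show ?thesis
    using dir_deriv_eqI by fastforce
qed

lemma smooth_on_continuous_iter:
  fixes f :: "'e::locally_convex_space \<Rightarrow> 'f::locally_convex_space"
  assumes "smooth_on U f"
  shows "continuous_on (U \<times> UNIV) (\<lambda>(x, w :: nat \<Rightarrow> 'e). iter_deriv f (map w ks) x)"
proof -
  define k where "k = length ks"
  have c: "continuous_on (U \<times> UNIV) (\<lambda>(x, w :: nat \<Rightarrow> 'e). iter_deriv f (map w [0..<k]) x)"
    using assms by (simp add: smooth_on_def)
  have h: "continuous_on (U \<times> UNIV) (\<lambda>(x, w :: nat \<Rightarrow> 'e). (x, \<lambda>i::nat. w (ks ! i)))"
    unfolding split_def
  proof (intro continuous_on_Pair continuous_on_fst continuous_on_id
      continuous_on_coordinatewise_then_product)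
    fix i
    have "continuous_on (U \<times> UNIV) ((\<lambda>w. w (ks ! i)) \<circ> (snd :: 'e \<times> (nat \<Rightarrow> 'e) \<Rightarrow> _))"
      by (intro continuous_on_compose continuous_on_snd continuous_on_id)
        (rule continuous_on_subset[OF continuous_on_product_coordinates], simp)
    then show "continuous_on (U \<times> UNIV) (\<lambda>x :: 'e \<times> (nat \<Rightarrow> 'e). snd x (ks ! i))"
      by (simp add: o_def)
  qed
  have "continuous_on (U \<times> UNIV) ((\<lambda>(x, w :: nat \<Rightarrow> 'e). iter_deriv f (map w [0..<k]) x)
      \<circ> (\<lambda>(x, w). (x, \<lambda>i. w (ks ! i))))"
    by (intro continuous_on_compose h continuous_on_subset[OF c]) auto
  moreover have "map (\<lambda>i. w (ks ! i)) [0..<k] = map w ks" for w :: "nat \<Rightarrow> 'e"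
    by (rule nth_equalityI) (auto simp: k_def)
  ultimately show ?thesis
    by (simp add: o_def split_def)
qed

lemma smooth_on_continuous_iter1:
  fixes f :: "'e::locally_convex_space \<Rightarrow> 'f::locally_convex_space"
  assumes "smooth_on U f"
  shows "continuous_on U (iter_deriv f vs)"
proof -
  have m: "map (nth vs) [0..<length vs] = vs"
    by (rule map_nth)
  have "continuous_on U ((\<lambda>(x, w :: nat \<Rightarrow> 'e). iter_deriv f (map w [0..<length vs]) x)
     \<circ> (\<lambda>x. (x, nth vs)))"
    by (intro continuous_on_compose continuous_intros
        continuous_on_subset[OF smooth_on_continuous_iter[OF assms]]) auto
  then show ?thesis
    by (simp add: o_def m)
qed

lemma smooth_onI_family:
  fixes f :: "'e::locally_convex_space \<Rightarrow> 'f::locally_convex_space"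
    and C :: "('e \<Rightarrow> (nat \<Rightarrow> 'e) \<Rightarrow> 'f) set"
  assumes U: "open U" and F0: "F0 \<in> C" "\<And>x w. x \<in> U \<Longrightarrow> F0 x w = f x"
    and cont: "\<And>F. F \<in> C \<Longrightarrow> continuous_on (U \<times> UNIV) (\<lambda>(x, w). F x w)"
    and der: "\<And>F k. F \<in> C \<Longrightarrow> \<exists>G\<in>C. \<forall>x\<in>U. \<forall>w. has_dir_deriv (\<lambda>x. F x w) (G x w) (w k) x"
  shows "smooth_on U f"
proof -
  have ex: "\<exists>G\<in>C. \<forall>x\<in>U. \<forall>w. iter_deriv f (map w ks) x = G x w" for ks
  proof (induction ks)
    case Nil
    then show ?case using F0 by (intro bexI[of _ F0]) auto
  next
    case (Cons k ks)
    then obtain F where F: "F \<in> C" "\<forall>x\<in>U. \<forall>w. iter_deriv f (map w ks) x = F x w"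
      by blast
    obtain G where G: "G \<in> C" "\<forall>x\<in>U. \<forall>w. has_dir_deriv (\<lambda>x. F x w) (G x w) (w k) x"
      using der[OF F(1)] by blast
    have "iter_deriv f (map w (k # ks)) x = G x w" if "x \<in> U" for x w
    proof -
      have "has_dir_deriv (iter_deriv f (map w ks)) (G x w) (w k) x"
        using has_dir_deriv_cong[OF U that, of "iter_deriv f (map w ks)" "\<lambda>x. F x w"] F G that
        by auto
      then show ?thesis
        by (simp add: dir_deriv_eqI)
    qed
    with G(1) show ?case by blast
  qed
  have "\<exists>l. has_dir_deriv (iter_deriv f vs) l v x" if "x \<in> U" for vs v x
  proof -
    define w where "w = nth (vs @ [v])"
    have w: "map w [0..<length vs] = vs" "w (length vs) = v"
      by (auto simp: w_def nth_append intro: nth_equalityI)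
    obtain F where F: "F \<in> C" "\<forall>x\<in>U. \<forall>w. iter_deriv f (map w [0..<length vs]) x = F x w"
      using ex by blast
    obtain G where G: "\<forall>x\<in>U. \<forall>w. has_dir_deriv (\<lambda>x. F x w) (G x w) (w (length vs)) x"
      using der[OF F(1)] by blast
    have "has_dir_deriv (iter_deriv f vs) (G x w) v x"
      using has_dir_deriv_cong[OF U that, of "iter_deriv f vs" "\<lambda>x. F x w"] F(2) G that
      by (metis w)
    then show ?thesis ..
  qed
  moreover have "continuous_on (U \<times> UNIV) (\<lambda>(x, w :: nat \<Rightarrow> 'e). iter_deriv f (map w [0..<k]) x)"
    for k
  proof -
    obtain F where F: "F \<in> C" "\<forall>x\<in>U. \<forall>w. iter_deriv f (map w [0..<k]) x = F x w"
      using ex by blast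
    show ?thesis
      using cont[OF F(1)] by (rule continuous_on_eq) (use F(2) in auto)
  qed
  ultimately show ?thesis
    using U unfolding smooth_on_def by blast
qed

lemma smooth_on_cong:
  assumes "smooth_on U f" "\<And>x. x \<in> U \<Longrightarrow> f x = g x"
  shows "smooth_on U g"
proof (rule smooth_onI_family)
  let ?F = "\<lambda>(ks :: nat list) x w. iter_deriv f (map w ks) x"
  show "open U" using assms by (simp add: smooth_on_open)
  show "?F [] \<in> range ?F" by blast
  show "?F [] x w = g x" if "x \<in> U" for x w using that assms(2) by simp
  fix F assume "F \<in> range ?F"
  then obtain ks where F: "F = ?F ks" by blast
  show "continuous_on (U \<times> UNIV) (\<lambda>(x, w). F x w)"
    unfolding F by (rule smooth_on_continuous_iter[OF assms(1)])
  show "\<exists>G\<in>range ?F. \<forall>x\<in>U. \<forall>w. has_dir_deriv (\<lambda>x. F x w) (G x w) (w k) x" for k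
    unfolding F using smooth_on_has_dir_deriv[OF assms(1)]
    by (intro bexI[OF _ rangeI[of ?F "k # ks"]]) auto
qed

lemma has_dir_deriv_add:
  assumes "has_dir_deriv f a v x" "has_dir_deriv g b v x"
  shows "has_dir_deriv (\<lambda>x. f x + g x) (a + b) v x"
  using tendsto_add[OF assms[unfolded has_dir_deriv_def]]
  unfolding has_dir_deriv_def by (simp add: algebra_simps)

lemma has_dir_deriv_scaleR:
  assumes "has_dir_deriv f a v x"
  shows "has_dir_deriv (\<lambda>x. c *\<^sub>R f x) (c *\<^sub>R a) v x"
  using tendsto_scaleR_lcs[OF tendsto_const[of c] assms[unfolded has_dir_deriv_def]]
  unfolding has_dir_deriv_def by (simp add: algebra_simps)

lemma has_dir_deriv_const: "has_dir_deriv (\<lambda>x. c) 0 v x"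
  unfolding has_dir_deriv_def by simp

lemma iter_deriv_add:
  assumes "smooth_on U f" "smooth_on U g"
  shows "x \<in> U \<Longrightarrow> iter_deriv (\<lambda>x. f x + g x) vs x = iter_deriv f vs x + iter_deriv g vs x"
proof (induction vs arbitrary: x)
  case (Cons v vs)
  have "has_dir_deriv (\<lambda>x. iter_deriv f vs x + iter_deriv g vs x)
      (iter_deriv f (v # vs) x + iter_deriv g (v # vs) x) v x"
    by (intro has_dir_deriv_add smooth_on_has_dir_deriv[OF assms(1)]
        smooth_on_has_dir_deriv[OF assms(2)] Cons.prems)
  moreover have "dir_deriv (iter_deriv (\<lambda>x. f x + g x) vs) v x =
      dir_deriv (\<lambda>x. iter_deriv f vs x + iter_deriv g vs x) v x"
    by (rule dir_deriv_cong[OF smooth_on_open[OF assms(1)]]) (use Cons in auto)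
  ultimately show ?case
    by (simp add: dir_deriv_eqI)
qed simp

lemma iter_deriv_scaleR:
  assumes "smooth_on U f"
  shows "x \<in> U \<Longrightarrow> iter_deriv (\<lambda>x. c *\<^sub>R f x) vs x = c *\<^sub>R iter_deriv f vs x"
proof (induction vs arbitrary: x)
  case (Cons v vs)
  have "has_dir_deriv (\<lambda>x. c *\<^sub>R iter_deriv f vs x) (c *\<^sub>R iter_deriv f (v # vs) x) v x"
    by (intro has_dir_deriv_scaleR smooth_on_has_dir_deriv[OF assms(1)] Cons.prems)
  moreover have "dir_deriv (iter_deriv (\<lambda>x. c *\<^sub>R f x) vs) v x =
      dir_deriv (\<lambda>x. c *\<^sub>R iter_deriv f vs x) v x"
    by (rule dir_deriv_cong[OF smooth_on_open[OF assms(1)]]) (use Cons in auto)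
  ultimately show ?case
    by (simp add: dir_deriv_eqI)
qed simp

lemma continuous_on_scaleR_lcs:
  fixes g :: "'a::topological_space \<Rightarrow> 'b::locally_convex_space"
  assumes "continuous_on S g"
  shows "continuous_on S (\<lambda>x. c *\<^sub>R g x)"
  using assms unfolding continuous_on_def by (auto intro: tendsto_scaleR_lcs)

lemma smooth_on_add:
  assumes "smooth_on U f" "smooth_on U g"
  shows "smooth_on U (\<lambda>x. f x + g x)"
proof (rule smooth_onI_family)
  let ?F = "\<lambda>(ks :: nat list) x w. iter_deriv f (map w ks) x + iter_deriv g (map w ks) x"
  show "open U" using assms by (simp add: smooth_on_open)
  show "?F [] \<in> range ?F" by blast
  show "?F [] x w = f x + g x" for x w by simp
  fix F assume "F \<in> range ?F"
  then obtain ks where F: "F = ?F ks" by blast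
  show "continuous_on (U \<times> UNIV) (\<lambda>(x, w). F x w)"
    unfolding F split_def
    using smooth_on_continuous_iter[OF assms(1)] smooth_on_continuous_iter[OF assms(2)]
    by (intro continuous_on_add) (auto simp: split_def)
  show "\<exists>G\<in>range ?F. \<forall>x\<in>U. \<forall>w. has_dir_deriv (\<lambda>x. F x w) (G x w) (w k) x" for k
    unfolding F
    by (intro bexI[OF _ rangeI[of ?F "k # ks"]] ballI allI has_dir_deriv_add)
      (use assms smooth_on_has_dir_deriv in auto)
qed

lemma smooth_on_scaleR:
  assumes "smooth_on U f"
  shows "smooth_on U (\<lambda>x. c *\<^sub>R f x)"
proof (rule smooth_onI_family)
  let ?F = "\<lambda>(ks :: nat list) x w. c *\<^sub>R iter_deriv f (map w ks) x"
  show "open U" using assms by (simp add: smooth_on_open)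
  show "?F [] \<in> range ?F" by blast
  show "?F [] x w = c *\<^sub>R f x" for x w by simp
  fix F assume "F \<in> range ?F"
  then obtain ks where F: "F = ?F ks" by blast
  show "continuous_on (U \<times> UNIV) (\<lambda>(x, w). F x w)"
    unfolding F split_def using smooth_on_continuous_iter[OF assms(1)]
    by (intro continuous_on_scaleR_lcs) (auto simp: split_def)
  show "\<exists>G\<in>range ?F. \<forall>x\<in>U. \<forall>w. has_dir_deriv (\<lambda>x. F x w) (G x w) (w k) x" for k
    unfolding F
    by (intro bexI[OF _ rangeI[of ?F "k # ks"]] ballI allI has_dir_deriv_scaleR)
      (use assms smooth_on_has_dir_deriv in auto)
qed

lemma smooth_on_const:
  assumes "open U"
  shows "smooth_on U (\<lambda>x. c)"
  by (rule smooth_onI_family[where C = "range (\<lambda>c x w. c)" and ?F0.0 = "\<lambda>x w. c"])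
    (use assms has_dir_deriv_const in \<open>auto simp: split_def\<close>)

lemma smooth_on_bounded_linear:
  fixes f :: "'e::real_normed_vector \<Rightarrow> 'f::real_normed_vector"
  assumes "open U" "bounded_linear f"
  shows "smooth_on U f"
proof (rule smooth_onI_family)
  interpret bounded_linear f by fact
  let ?C = "{\<lambda>x w. f x, \<lambda>x w. 0} \<union> range (\<lambda>k x (w :: nat \<Rightarrow> 'e). f (w k))"
  show "open U" by fact
  show "(\<lambda>x w. f x) \<in> ?C" by blast
  show "f x = f x" for x by simp
  have c: "continuous_on UNIV f"
    by (simp add: linear_continuous_on bounded_linear_axioms)
  have c2: "continuous_on (U \<times> UNIV) (\<lambda>x :: 'e \<times> (nat \<Rightarrow> 'e). f (snd x k))" for k
  proof -
    have "continuous_on (U \<times> UNIV) (f \<circ> (\<lambda>w. w k) \<circ> (snd :: 'e \<times> (nat \<Rightarrow> 'e) \<Rightarrow> _))"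
      by (intro continuous_on_compose continuous_on_snd continuous_on_id continuous_on_subset[OF c])
        (auto intro: continuous_on_subset[OF continuous_on_product_coordinates])
    then show ?thesis by (simp add: o_def)
  qed
  have c1: "continuous_on (U \<times> UNIV) (\<lambda>x :: 'e \<times> (nat \<Rightarrow> 'e). f (fst x))"
    by (intro continuous_on_compose2[OF c]) (auto intro!: continuous_intros)
  have d: "has_dir_deriv f (f v) v x" for v x
    unfolding has_dir_deriv_def
    by (rule tendsto_eventually) (auto simp: eventually_at_filter add scaleR)
  fix F assume F: "F \<in> ?C"
  show "continuous_on (U \<times> UNIV) (\<lambda>(x, w). F x w)"
    using F c1 c2 by (auto simp: split_def)
  show "\<exists>G\<in>?C. \<forall>x\<in>U. \<forall>w. has_dir_deriv (\<lambda>x. F x w) (G x w) (w k) x" for k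
  proof (cases "F = (\<lambda>x w. f x)")
    case True
    then show ?thesis
      using d by (intro bexI[of _ "\<lambda>x w. f (w k)"]) auto
  next
    case False
    then show ?thesis
      using F has_dir_deriv_const by (intro bexI[of _ "\<lambda>x w. 0"]) auto
  qed
qed

lemma has_dir_deriv_real_iff:
  fixes f :: "'e::locally_convex_space \<Rightarrow> real"
  shows "has_dir_deriv f l v x \<longleftrightarrow> ((\<lambda>t. f (x + t *\<^sub>R v)) has_field_derivative l) (at 0)"
  by (simp add: has_dir_deriv_def DERIV_def divide_inverse mult.commute)

inductive_set fun_algebra :: "('a \<Rightarrow> 'b \<Rightarrow> real) set \<Rightarrow> ('a \<Rightarrow> 'b \<Rightarrow> real) set" for B where
  base: "F \<in> B \<Longrightarrow> F \<in> fun_algebra B"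
| const: "(\<lambda>x w. c) \<in> fun_algebra B"
| add: "F \<in> fun_algebra B \<Longrightarrow> G \<in> fun_algebra B \<Longrightarrow> (\<lambda>x w. F x w + G x w) \<in> fun_algebra B"
| mult: "F \<in> fun_algebra B \<Longrightarrow> G \<in> fun_algebra B \<Longrightarrow> (\<lambda>x w. F x w * G x w) \<in> fun_algebra B"

lemma smooth_on_fun_algebra:
  fixes f :: "'e::locally_convex_space \<Rightarrow> real"
    and B :: "('e \<Rightarrow> (nat \<Rightarrow> 'e) \<Rightarrow> real) set"
  assumes U: "open U" and f: "(\<lambda>x w. f x) \<in> fun_algebra B"
    and cont: "\<And>F. F \<in> B \<Longrightarrow> continuous_on (U \<times> UNIV) (\<lambda>(x, w). F x w)"
    and der: "\<And>F k. F \<in> B \<Longrightarrow>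
      \<exists>G\<in>fun_algebra B. \<forall>x\<in>U. \<forall>w. has_dir_deriv (\<lambda>x. F x w) (G x w) (w k) x"
  shows "smooth_on U f"
proof (rule smooth_onI_family[OF U f])
  fix F assume F: "F \<in> fun_algebra B"
  show "continuous_on (U \<times> UNIV) (\<lambda>(x, w). F x w)"
    using F by induction (use cont in \<open>auto simp: split_def intro!: continuous_intros\<close>)
  show "\<exists>G\<in>fun_algebra B. \<forall>x\<in>U. \<forall>w. has_dir_deriv (\<lambda>x. F x w) (G x w) (w k) x" for k
    using F
  proof induction
    case (base F)
    then show ?case by (rule der)
  next
    case (const c)
    then show ?case
      by (intro bexI[OF _ fun_algebra.const[of 0]]) (auto simp: has_dir_deriv_const)
  next
    case (add F G)
    then obtain F' G' where "F' \<in> fun_algebra B" "G' \<in> fun_algebra B"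
      "\<forall>x\<in>U. \<forall>w. has_dir_deriv (\<lambda>x. F x w) (F' x w) (w k) x"
      "\<forall>x\<in>U. \<forall>w. has_dir_deriv (\<lambda>x. G x w) (G' x w) (w k) x"
      by blast
    then show ?case
      by (intro bexI[OF _ fun_algebra.add[of F' _ G']]) (auto intro: has_dir_deriv_add)
  next
    case (mult F G)
    then obtain F' G' where *: "F' \<in> fun_algebra B" "G' \<in> fun_algebra B"
      "\<forall>x\<in>U. \<forall>w. has_dir_deriv (\<lambda>x. F x w) (F' x w) (w k) x"
      "\<forall>x\<in>U. \<forall>w. has_dir_deriv (\<lambda>x. G x w) (G' x w) (w k) x"
      by blast
    have "has_dir_deriv (\<lambda>x. F x w * G x w) (F' x w * G x w + F x w * G' x w) (w k) x"
      if "x \<in> U" for x w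
      using * that DERIV_mult[of "\<lambda>t. F (x + t *\<^sub>R w k) w" "F' x w" 0 UNIV
          "\<lambda>t. G (x + t *\<^sub>R w k) w" "G' x w"]
      by (auto simp: has_dir_deriv_real_iff algebra_simps)
    then show ?case
      by (intro bexI[OF _ fun_algebra.add[OF fun_algebra.mult[OF *(1) mult(2)]
            fun_algebra.mult[OF mult(1) *(2)]]]) auto
  qed
qed simp

lemma smooth_on_mult:
  fixes f g :: "'e::locally_convex_space \<Rightarrow> real"
  assumes "smooth_on U f" "smooth_on U g"
  shows "smooth_on U (\<lambda>x. f x * g x)"
proof (rule smooth_on_fun_algebra)
  let ?F = "\<lambda>f (ks :: nat list) x w. iter_deriv f (map w ks) x"
  let ?B = "{?F h ks | h ks. h \<in> {f, g}}"
  show "open U" using assms by (simp add: smooth_on_open)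
  have "?F f [] \<in> fun_algebra ?B" "?F g [] \<in> fun_algebra ?B"
    by (rule fun_algebra.base, blast)+
  from fun_algebra.mult[OF this] show "(\<lambda>x w. f x * g x) \<in> fun_algebra ?B"
    by simp
  fix F assume "F \<in> ?B"
  then obtain h ks where F: "F = ?F h ks" "h \<in> {f, g}" by blast
  then have h: "smooth_on U h" using assms by auto
  show "continuous_on (U \<times> UNIV) (\<lambda>(x, w). F x w)"
    unfolding F by (rule smooth_on_continuous_iter[OF h])
  show "\<exists>G\<in>fun_algebra ?B. \<forall>x\<in>U. \<forall>w. has_dir_deriv (\<lambda>x. F x w) (G x w) (w k) x" for k
  proof (rule bexI)
    show "?F h (k # ks) \<in> fun_algebra ?B"
      using F by (intro fun_algebra.base) blast
    show "\<forall>x\<in>U. \<forall>w. has_dir_deriv (\<lambda>x. F x w) (?F h (k # ks) x w) (w k) x"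
      using smooth_on_has_dir_deriv[OF h] unfolding F by simp
  qed
qed

lemma smooth_on_inverse:
  fixes g :: "'e::locally_convex_space \<Rightarrow> real"
  assumes g: "smooth_on U g" and nz: "\<And>x. x \<in> U \<Longrightarrow> g x \<noteq> 0"
  shows "smooth_on U (\<lambda>x. inverse (g x))"
proof (rule smooth_on_fun_algebra)
  let ?F = "\<lambda>(ks :: nat list) x w. iter_deriv g (map w ks) x"
  let ?I = "\<lambda>x (w :: nat \<Rightarrow> 'e). inverse (g x)"
  let ?B = "insert ?I (range ?F)"
  show "open U" using assms by (simp add: smooth_on_open)
  show I: "?I \<in> fun_algebra ?B"
    by (rule fun_algebra.base) blast
  have B: "?F ks \<in> fun_algebra ?B" for ks
    by (rule fun_algebra.base) blast
  have c: "continuous_on U g"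
    using smooth_on_continuous_iter1[OF g, of "[]"] by simp
  fix F assume "F \<in> ?B"
  then consider "F = ?I" | ks where "F = ?F ks" by blast
  note F = this
  show "continuous_on (U \<times> UNIV) (\<lambda>(x, w). F x w)"
    using F
  proof cases
    case 1
    show ?thesis
      unfolding 1 split_def
      by (intro continuous_on_inverse continuous_on_compose2[OF c] continuous_intros)
        (auto simp: nz)
  next
    case 2
    show ?thesis unfolding 2 by (rule smooth_on_continuous_iter[OF g])
  qed
  show "\<exists>G\<in>fun_algebra ?B. \<forall>x\<in>U. \<forall>w. has_dir_deriv (\<lambda>x. F x w) (G x w) (w k) x" for k
    using F
  proof cases
    case 1
    show ?thesis
    proof (rule bexI)
      let ?G = "\<lambda>x w. (-1) * ((inverse (g x) * ?F [k] x w) * inverse (g x))"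
      show "?G \<in> fun_algebra ?B"
        by (rule fun_algebra.mult[OF fun_algebra.const fun_algebra.mult[OF fun_algebra.mult[OF I B] I]])
      have "has_dir_deriv (\<lambda>x. inverse (g x)) (?G x w) (w k) x" if "x \<in> U" for x w
        using DERIV_inverse'[of "\<lambda>t. g (x + t *\<^sub>R w k)" "?F [k] x w" 0 UNIV] nz[OF that]
          smooth_on_has_dir_deriv[OF g that, of "[]" "w k"]
        by (simp add: has_dir_deriv_real_iff)
      then show "\<forall>x\<in>U. \<forall>w. has_dir_deriv (\<lambda>x. F x w) (?G x w) (w k) x"
        unfolding 1 by blast
    qed
  next
    case (2 ks)
    show ?thesis
      unfolding 2 using smooth_on_has_dir_deriv[OF g]
      by (intro bexI[OF _ B[of "k # ks"]]) simp
  qed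
qed

lemma smooth_on_vec:
  fixes f :: "'e::locally_convex_space \<Rightarrow> real ^ 'n"
  assumes f: "\<And>i. smooth_on U (\<lambda>x. f x $ i)"
  shows "smooth_on U f"
proof (rule smooth_onI_family)
  let ?F = "\<lambda>(ks :: nat list) x w. (\<chi> i. iter_deriv (\<lambda>x. f x $ i) (map w ks) x)"
  show "open U" using f by (rule smooth_on_open)
  show "?F [] \<in> range ?F" by blast
  show "?F [] x w = f x" for x w by simp
  fix F assume "F \<in> range ?F"
  then obtain ks where F: "F = ?F ks" by blast
  show "continuous_on (U \<times> UNIV) (\<lambda>(x, w). F x w)"
    unfolding F split_def using smooth_on_continuous_iter[OF f]
    by (intro continuous_on_vec_lambda) (auto simp: split_def)
  have "has_dir_deriv (\<lambda>x. ?F ks x w) (?F (k # ks) x w) (w k) x" if "x \<in> U" for x w k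
    unfolding has_dir_deriv_def
    by (rule vec_tendstoI)
      (use smooth_on_has_dir_deriv[OF f that] in \<open>simp add: has_dir_deriv_def\<close>)
  then show "\<exists>G\<in>range ?F. \<forall>x\<in>U. \<forall>w. has_dir_deriv (\<lambda>x. F x w) (G x w) (w k) x" for k
    unfolding F by (intro bexI[OF _ rangeI[of ?F "k # ks"]]) auto
qed


section \<open>Manifolds\<close>

text \<open>A chart \<open>(U, \<phi>)\<close> of a manifold modelled on \<open>'e\<close> consists of its domain \<open>U\<close> and
  a map \<open>\<phi>\<close>, whose values outside \<open>U\<close> are irrelevant.\<close>

type_synonym ('m, 'e) chart = "'m set \<times> ('m \<Rightarrow> 'e)"
type_synonym ('m, 'e) atlas = "('m, 'e) chart set"

definition mfd_open :: "('m, 'e::locally_convex_space) atlas \<Rightarrow> 'm set \<Rightarrow> bool" where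
  "mfd_open A W \<longleftrightarrow> W \<subseteq> \<Union> (fst ` A) \<and> (\<forall>(U, \<phi>)\<in>A. open (\<phi> ` (U \<inter> W)))"

text \<open>Continuity is part of the following definition, because \<^const>\<open>smooth_on\<close> requires its
  domain to be open.\<close>

definition mfd_smooth_on ::
    "('m, 'e::locally_convex_space) atlas \<Rightarrow> ('n, 'f::locally_convex_space) atlas
      \<Rightarrow> 'm set \<Rightarrow> ('m \<Rightarrow> 'n) \<Rightarrow> bool" where
  "mfd_smooth_on A B W f \<longleftrightarrow> mfd_open A W \<and> f ` W \<subseteq> \<Union> (fst ` B) \<and>
     (\<forall>(U, \<phi>)\<in>A. \<forall>(V, \<psi>)\<in>B.
        smooth_on (\<phi> ` {x \<in> U \<inter> W. f x \<in> V}) (\<psi> \<circ> f \<circ> inv_into U \<phi>))"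

definition mfd_diffeo ::
    "('m, 'e::locally_convex_space) atlas \<Rightarrow> ('n, 'f::locally_convex_space) atlas
      \<Rightarrow> 'm set \<Rightarrow> 'n set \<Rightarrow> ('m \<Rightarrow> 'n) \<Rightarrow> bool" where
  "mfd_diffeo A B V W f \<longleftrightarrow> bij_betw f V W \<and>
     mfd_smooth_on A B V f \<and> mfd_smooth_on B A W (inv_into V f)"

definition model_atlas :: "('e, 'e) atlas" where
  "model_atlas = {(UNIV, id)}"

definition prod_atlas :: "('m, 'e) atlas \<Rightarrow> ('n, 'f) atlas \<Rightarrow> ('m \<times> 'n, 'e \<times> 'f) atlas" where
  "prod_atlas A B = {(U \<times> V, map_prod \<phi> \<psi>) | U \<phi> V \<psi>. (U, \<phi>) \<in> A \<and> (V, \<psi>) \<in> B}"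

text \<open>The maximal atlas of an embedded submanifold \<open>M\<close> of a Euclidean space: inverses of the
  smooth immersions of open sets which are homeomorphisms onto open subsets of \<open>M\<close>.\<close>

definition submanifold_atlas ::
    "'a::euclidean_space set \<Rightarrow> ('a, 'e::euclidean_space) atlas" where
  "submanifold_atlas M = {(U, \<phi>).
     openin (top_of_set M) U \<and> inj_on \<phi> U \<and> continuous_on U \<phi> \<and>
     smooth_on (\<phi> ` U) (inv_into U \<phi>) \<and>
     (\<forall>y\<in>\<phi> ` U. \<exists>D. (inv_into U \<phi> has_derivative D) (at y) \<and> inj D)}"


section \<open>Exponential functions and local exponentiality\<close>

text \<open>A Lie group is given by a group \<open>H\<close> together with an atlas \<open>A\<close> of its carrier.
  A chart \<open>(U, \<phi>)\<close> at the identity identifies the Lie algebra, as a locally convex space,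
  with the model space \<open>'e\<close>: a curve \<open>\<gamma>\<close> through the identity
  has the derivative \<open>x\<close> at \<open>0\<close> iff \<open>\<phi> \<circ> \<gamma>\<close> does. A different chart at the identity changes this
  identification by a linear homeomorphism of \<open>'e\<close>.\<close>

definition one_parameter_group :: "'h monoid \<Rightarrow> ('h, 'e::locally_convex_space) atlas
      \<Rightarrow> (real \<Rightarrow> 'h) \<Rightarrow> bool" where
  "one_parameter_group H A \<gamma> \<longleftrightarrow> range \<gamma> \<subseteq> carrier H \<and>
     (\<forall>s t. \<gamma> (s + t) = \<gamma> s \<otimes>\<^bsub>H\<^esub> \<gamma> t) \<and> mfd_smooth_on model_atlas A UNIV \<gamma>"

definition exponential_function ::
    "'h monoid \<Rightarrow> ('h, 'e::locally_convex_space) atlas \<Rightarrow> ('h, 'e) chart \<Rightarrow> ('e \<Rightarrow> 'h) \<Rightarrow> bool" where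
  "exponential_function H A c ex \<longleftrightarrow> mfd_smooth_on model_atlas A UNIV ex \<and>
     (\<forall>x. one_parameter_group H A (\<lambda>t. ex (t *\<^sub>R x)) \<and>
       ((\<lambda>t::real. (snd c (ex (t *\<^sub>R x)) - snd c \<one>\<^bsub>H\<^esub>) /\<^sub>R t) \<longlongrightarrow> x) (at 0))"

definition locally_exponential :: "'h monoid \<Rightarrow> ('h, 'e::locally_convex_space) atlas \<Rightarrow> bool" where
  "locally_exponential H A \<longleftrightarrow>
     (\<exists>c\<in>A. \<one>\<^bsub>H\<^esub> \<in> fst c \<and>
       (\<exists>ex. exponential_function H A c ex \<and>
         (\<exists>V W. open V \<and> 0 \<in> V \<and> mfd_open A W \<and> \<one>\<^bsub>H\<^esub> \<in> W \<and>
           mfd_diffeo model_atlas A V W ex)))"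


section \<open>The Frechet space of smooth functions on the sphere\<close>

definition sphere_atlas :: "(real ^ 3, real ^ 2) atlas" where
  "sphere_atlas = submanifold_atlas (sphere 0 1)"

subsection \<open>Stereographic charts\<close>

definition proj2 :: "real ^ 3 \<Rightarrow> real ^ 2" where
  "proj2 x = vector [x $ 1, x $ 2]"

definition stereo :: "real \<Rightarrow> real ^ 3 \<Rightarrow> real ^ 2" where
  "stereo e x = proj2 (inverse (1 - e * x $ 3) *\<^sub>R x)"

definition emb3 :: "real ^ 2 \<Rightarrow> real ^ 3" where
  "emb3 y = vector [2 * y $ 1, 2 * y $ 2, 0]"

definition stereo_inv :: "real \<Rightarrow> real ^ 2 \<Rightarrow> real ^ 3" where
  "stereo_inv e y = inverse (1 + y \<bullet> y) *\<^sub>R (emb3 y + (e * (y \<bullet> y - 1)) *\<^sub>R axis 3 1)"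

definition stereo_dom :: "real \<Rightarrow> (real ^ 3) set" where
  "stereo_dom e = {x \<in> sphere 0 1. x $ 3 \<noteq> e}"

lemma bounded_linear_proj2: "bounded_linear proj2"
  unfolding linear_conv_bounded_linear[symmetric] proj2_def
  by (rule linearI) (simp_all add: vec_eq_iff forall_2)

lemma bounded_linear_emb3: "bounded_linear emb3"
  unfolding linear_conv_bounded_linear[symmetric] emb3_def
  by (rule linearI) (simp_all add: vec_eq_iff forall_3)

lemma inner_2: "(y :: real ^ 2) \<bullet> y = (y $ 1)\<^sup>2 + (y $ 2)\<^sup>2"
  by (simp add: inner_vec_def sum_2 power2_eq_square)

lemma inner_3: "(y :: real ^ 3) \<bullet> y = (y $ 1)\<^sup>2 + (y $ 2)\<^sup>2 + (y $ 3)\<^sup>2"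
  by (simp add: inner_vec_def sum_3 power2_eq_square)

lemma sphere_3_iff: "x \<in> sphere (0 :: real ^ 3) 1 \<longleftrightarrow> (x $ 1)\<^sup>2 + (x $ 2)\<^sup>2 + (x $ 3)\<^sup>2 = 1"
  by (simp add: norm_eq_1 inner_3)

lemma stereo_inv_nth:
  "stereo_inv e y $ 1 = 2 * y $ 1 * inverse (1 + y \<bullet> y)"
  "stereo_inv e y $ 2 = 2 * y $ 2 * inverse (1 + y \<bullet> y)"
  "stereo_inv e y $ 3 = e * (y \<bullet> y - 1) * inverse (1 + y \<bullet> y)"
  by (simp_all add: stereo_inv_def emb3_def axis_def)

lemma one_plus_inner_pos: "1 + (y :: real ^ 2) \<bullet> y > 0"
  by (simp add: add_pos_nonneg)

lemma smooth_on_stereo_inv: "smooth_on UNIV (stereo_inv e)"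
proof (rule smooth_on_vec)
  have n: "smooth_on UNIV (\<lambda>y :: real ^ 2. y $ i)" for i
    by (rule smooth_on_bounded_linear) (auto intro: bounded_linear_vec_nth)
  have q: "smooth_on UNIV (\<lambda>y :: real ^ 2. y \<bullet> y + c)" for c
    unfolding inner_2 power2_eq_square
    by (intro smooth_on_add smooth_on_mult n smooth_on_const) simp
  have i: "smooth_on UNIV (\<lambda>y :: real ^ 2. inverse (1 + y \<bullet> y))"
    using smooth_on_inverse[OF q[of 1]] one_plus_inner_pos
    by (simp add: add.commute less_imp_neq[symmetric])
  have "smooth_on UNIV (\<lambda>y. stereo_inv e y $ 1)" "smooth_on UNIV (\<lambda>y. stereo_inv e y $ 2)"
    unfolding stereo_inv_nth by (intro smooth_on_mult i n smooth_on_const; simp)+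
  moreover have "smooth_on UNIV (\<lambda>y. stereo_inv e y $ 3)"
    unfolding stereo_inv_nth using q[of "-1"]
    by (intro smooth_on_mult i smooth_on_const) auto
  ultimately show "smooth_on UNIV (\<lambda>y. stereo_inv e y $ i)" for i
    using exhaust_3[of i] by metis
qed

lemma stereo_stereo_inv:
  assumes "e\<^sup>2 = 1"
  shows "stereo e (stereo_inv e y) = y" "stereo_inv e y \<in> stereo_dom e"
proof -
  have p: "1 + y \<bullet> y \<noteq> 0"
    using one_plus_inner_pos[of y] by simp
  have ee: "e * e = 1" "e \<noteq> 0"
    using assms by (auto simp: power2_eq_square)
  have 3: "1 - e * stereo_inv e y $ 3 = 2 * inverse (1 + y \<bullet> y)"
  proof -
    have "e * stereo_inv e y $ 3 = (e * e) * (y \<bullet> y - 1) * inverse (1 + y \<bullet> y)"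
      by (simp add: stereo_inv_nth)
    with p show ?thesis
      by (simp add: ee field_simps)
  qed
  show "stereo e (stereo_inv e y) = y"
    unfolding stereo_def 3 proj2_def vec_eq_iff forall_2 using p
    by (simp add: stereo_inv_nth field_simps)
  have "stereo_inv e y $ 3 \<noteq> e"
    using 3 p ee by auto
  moreover have "stereo_inv e y \<in> sphere 0 1"
  proof -
    have "(stereo_inv e y $ 1)\<^sup>2 + (stereo_inv e y $ 2)\<^sup>2 + (stereo_inv e y $ 3)\<^sup>2 =
        (4 * (y \<bullet> y) + e\<^sup>2 * (y \<bullet> y - 1)\<^sup>2) * (inverse (1 + y \<bullet> y))\<^sup>2"
      unfolding stereo_inv_nth power_mult_distrib inner_2[of y] by (simp add: algebra_simps)
    also have "4 * (y \<bullet> y) + e\<^sup>2 * (y \<bullet> y - 1)\<^sup>2 = (1 + y \<bullet> y)\<^sup>2"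
      unfolding assms by (simp add: power2_eq_square algebra_simps)
    finally show ?thesis
      unfolding sphere_3_iff using p by (simp add: power_mult_distrib[symmetric])
  qed
  ultimately show "stereo_inv e y \<in> stereo_dom e"
    by (simp add: stereo_dom_def)
qed

lemma stereo_inv_stereo:
  assumes "e\<^sup>2 = 1" "x \<in> stereo_dom e"
  shows "stereo_inv e (stereo e x) = x"
proof -
  have ee: "e * e = 1" "e \<noteq> 0"
    using assms by (auto simp: power2_eq_square)
  define d where "d = 1 - e * x $ 3"
  have ex: "e * (e * a) = a" for a
    using ee(1) by (simp add: mult.assoc[symmetric])
  have x3: "x $ 3 = e * (1 - d)"
    by (simp add: d_def algebra_simps ex)
  have d: "d \<noteq> 0"
    using assms x3 by (auto simp: stereo_dom_def)
  have s: "(x $ 1)\<^sup>2 + (x $ 2)\<^sup>2 = 2 * d - d\<^sup>2"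
  proof -
    have "(x $ 3)\<^sup>2 = (1 - d)\<^sup>2"
      unfolding x3 power_mult_distrib assms by simp
    then show ?thesis
      using assms(2) unfolding stereo_dom_def sphere_3_iff
      by (simp add: power2_eq_square algebra_simps)
  qed
  let ?y = "stereo e x"
  have y: "?y $ 1 = x $ 1 / d" "?y $ 2 = x $ 2 / d"
    by (simp_all add: stereo_def proj2_def d_def divide_inverse mult.commute)
  have "?y \<bullet> ?y = ((x $ 1)\<^sup>2 + (x $ 2)\<^sup>2) / d\<^sup>2"
    unfolding inner_2 y by (simp add: power_divide add_divide_distrib)
  also have "\<dots> = 2 / d - 1"
    unfolding s using d by (simp add: power2_eq_square field_simps)
  finally have yy: "?y \<bullet> ?y = 2 / d - 1" .
  have "stereo_inv e ?y $ 1 = x $ 1" "stereo_inv e ?y $ 2 = x $ 2" "stereo_inv e ?y $ 3 = x $ 3"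
    unfolding stereo_inv_nth yy x3 using d by (simp_all add: y x3 field_simps)
  then show ?thesis
    by (simp add: vec_eq_iff forall_3)
qed

lemma stereo_differentiable:
  assumes "1 - e * x $ 3 \<noteq> 0"
  shows "stereo e differentiable (at x)"
proof -
  have "(\<lambda>x. inverse (1 - e * x $ 3) *\<^sub>R x) differentiable (at x)"
    using assms
    by (intro differentiable_scaleR differentiable_inverse differentiable_diff differentiable_mult
        differentiable_const differentiable_ident bounded_linear_imp_differentiable
        bounded_linear_vec_nth) auto
  from differentiable_chain_at[OF this bounded_linear_imp_differentiable[OF bounded_linear_proj2]]
  have "(proj2 \<circ> (\<lambda>x. inverse (1 - e * x $ 3) *\<^sub>R x)) differentiable (at x)" .
  then show ?thesis
    by (simp add: o_def stereo_def[abs_def])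
qed

lemma stereo_inv_differentiable: "stereo_inv e differentiable (at y)"
  unfolding stereo_inv_def[abs_def] using one_plus_inner_pos[of y]
  by (intro differentiable_scaleR differentiable_inverse differentiable_add differentiable_diff
      differentiable_mult differentiable_const differentiable_ident differentiable_inner
      bounded_linear_imp_differentiable bounded_linear_emb3) auto

lemma stereo_chart:
  assumes e: "e\<^sup>2 = 1"
  shows "(stereo_dom e, stereo e) \<in> sphere_atlas" "stereo e ` stereo_dom e = UNIV"
proof -
  show im: "stereo e ` stereo_dom e = UNIV"
    using stereo_stereo_inv[OF e] by (metis UNIV_eq_I imageI)
  have inj: "inj_on (stereo e) (stereo_dom e)"
    using stereo_inv_stereo[OF e] by (metis inj_onI)
  have inv: "inv_into (stereo_dom e) (stereo e) = stereo_inv e"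
    using stereo_stereo_inv[OF e] inj by (metis inv_into_f_f ext)
  have nz: "1 - e * x $ 3 \<noteq> 0" if "x \<in> stereo_dom e" for x
  proof
    assume "1 - e * x $ 3 = 0"
    then have "e * e * x $ 3 = e" unfolding mult.assoc by simp
    then have "x $ 3 = e" using e by (metis mult_1 power2_eq_square)
    with that show False by (simp add: stereo_dom_def)
  qed
  have cont: "continuous_on (stereo_dom e) (stereo e)"
    using stereo_differentiable[OF nz]
    by (intro continuous_at_imp_continuous_on ballI differentiable_imp_continuous_within)
  have "open ((\<lambda>x :: real ^ 3. x $ 3) -` (- {e}))"
    by (intro open_vimage_vec_nth) auto
  then have op: "openin (top_of_set (sphere 0 1)) (stereo_dom e)"
    unfolding openin_open stereo_dom_def
    by (intro exI[of _ "(\<lambda>x :: real ^ 3. x $ 3) -` (- {e})"]) auto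
  have "\<exists>D. (stereo_inv e has_derivative D) (at y) \<and> inj D" for y
  proof -
    obtain D where D: "(stereo_inv e has_derivative D) (at y)"
      using stereo_inv_differentiable unfolding differentiable_def by blast
    obtain E where E: "(stereo e has_derivative E) (at (stereo_inv e y))"
      using stereo_differentiable[OF nz[OF stereo_stereo_inv(2)[OF e]]]
      unfolding differentiable_def by blast
    have "(stereo e \<circ> stereo_inv e has_derivative E \<circ> D) (at y)"
      by (rule diff_chain_at[OF D E])
    moreover have "stereo e \<circ> stereo_inv e = id"
      using stereo_stereo_inv[OF e] by (simp add: fun_eq_iff)
    ultimately have "E \<circ> D = id"
      using has_derivative_unique has_derivative_id by (metis id_def)
    then have "inj D"
      by (metis inj_on_id inj_on_imageI2)
    with D show ?thesis by blast
  qed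
  then show "(stereo_dom e, stereo e) \<in> sphere_atlas"
    unfolding sphere_atlas_def submanifold_atlas_def
    using op inj cont smooth_on_stereo_inv by (simp add: inv im)
qed

lemma sphere_atlas_covers: "\<Union> (fst ` sphere_atlas) = sphere 0 1"
proof
  show "\<Union> (fst ` sphere_atlas) \<subseteq> sphere 0 1"
    by (auto simp: sphere_atlas_def submanifold_atlas_def dest!: openin_imp_subset)
  have "sphere 0 1 = stereo_dom 1 \<union> stereo_dom (-1)"
    by (auto simp: stereo_dom_def)
  then show "sphere 0 1 \<subseteq> \<Union> (fst ` sphere_atlas)"
    using stereo_chart(1)[of 1] stereo_chart(1)[of "-1"] by force
qed

lemma sphere_chart_image_open: "(U, \<phi>) \<in> sphere_atlas \<Longrightarrow> open (\<phi> ` U)"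
  by (auto simp: sphere_atlas_def submanifold_atlas_def smooth_on_open)

lemma sphere_chart_subset: "(U, \<phi>) \<in> sphere_atlas \<Longrightarrow> U \<subseteq> sphere 0 1"
  by (auto simp: sphere_atlas_def submanifold_atlas_def dest!: openin_imp_subset)

lemma mfd_smooth_on_sphere_iff:
  fixes f :: "real ^ 3 \<Rightarrow> 'f::locally_convex_space"
  shows "mfd_smooth_on sphere_atlas model_atlas (sphere 0 1) f \<longleftrightarrow>
    (\<forall>(U, \<phi>)\<in>sphere_atlas. smooth_on (\<phi> ` U) (f \<circ> inv_into U \<phi>))"
proof -
  have *: "U \<inter> sphere 0 1 = U" if "(U, \<phi>) \<in> sphere_atlas" for U \<phi>
    using sphere_chart_subset[OF that] by blast
  have "mfd_open sphere_atlas (sphere 0 1)"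
    using * sphere_atlas_covers sphere_chart_image_open by (fastforce simp: mfd_open_def)
  then show ?thesis
    unfolding mfd_smooth_on_def model_atlas_def using * by (fastforce simp: o_def)
qed


subsection \<open>The vector space structure\<close>

text \<open>A function on the sphere is represented by its extension by \<open>0\<close>.\<close>

typedef sphere_fun = "{f :: real ^ 3 \<Rightarrow> real.
    mfd_smooth_on sphere_atlas model_atlas (sphere 0 1) f \<and> (\<forall>x. x \<notin> sphere 0 1 \<longrightarrow> f x = 0)}"
  morphisms sphere_eval Abs_sphere_fun
proof (rule exI[of _ "\<lambda>x. 0"], simp add: mfd_smooth_on_sphere_iff o_def, clarify)
  fix U \<phi> assume "(U, \<phi>) \<in> sphere_atlas"
  then show "smooth_on (\<phi> ` U) (\<lambda>x. 0 :: real)"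
    by (intro smooth_on_const sphere_chart_image_open)
qed

setup_lifting type_definition_sphere_fun

instantiation sphere_fun :: real_vector
begin

lift_definition zero_sphere_fun :: sphere_fun is "\<lambda>x. 0"
  by (auto simp: mfd_smooth_on_sphere_iff o_def intro!: smooth_on_const sphere_chart_image_open)

lift_definition plus_sphere_fun :: "sphere_fun \<Rightarrow> sphere_fun \<Rightarrow> sphere_fun" is
  "\<lambda>f g x. f x + g x"
  by (auto simp: mfd_smooth_on_sphere_iff o_def intro!: smooth_on_add)

lift_definition scaleR_sphere_fun :: "real \<Rightarrow> sphere_fun \<Rightarrow> sphere_fun" is
  "\<lambda>c f x. c *\<^sub>R f x"
  by (auto simp: mfd_smooth_on_sphere_iff o_def simp del: real_scaleR_def intro!: smooth_on_scaleR)

definition uminus_sphere_fun :: "sphere_fun \<Rightarrow> sphere_fun" where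
  "uminus_sphere_fun f = (-1) *\<^sub>R f"

definition minus_sphere_fun :: "sphere_fun \<Rightarrow> sphere_fun \<Rightarrow> sphere_fun" where
  "minus_sphere_fun f g = f + (-1) *\<^sub>R g"

instance
  by standard
    (unfold uminus_sphere_fun_def minus_sphere_fun_def,
     (transfer, auto simp: fun_eq_iff algebra_simps)+)

end

lemma sphere_eval_add: "sphere_eval (f + g) x = sphere_eval f x + sphere_eval g x"
  by transfer simp

lemma sphere_eval_scaleR: "sphere_eval (c *\<^sub>R f) x = c * sphere_eval f x"
  by transfer simp

lemma sphere_eval_diff: "sphere_eval (f - g) x = sphere_eval f x - sphere_eval g x"
  unfolding minus_sphere_fun_def sphere_eval_add sphere_eval_scaleR by simp

lemma sphere_eval_zero: "sphere_eval 0 x = 0"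
  by transfer simp

lemma smooth_on_sphere_eval:
  assumes "(U, \<phi>) \<in> sphere_atlas"
  shows "smooth_on (\<phi> ` U) (\<lambda>y. sphere_eval f (inv_into U \<phi> y))"
  using sphere_eval[of f] assms by (fastforce simp: mfd_smooth_on_sphere_iff o_def)


subsection \<open>The topology\<close>

text \<open>Uniform convergence of all derivatives, in all charts, on compact subsets of the chart
  images.\<close>

definition chart_deriv :: "(real ^ 3, real ^ 2) chart \<Rightarrow> (real ^ 2) list \<Rightarrow> sphere_fun \<Rightarrow>
    real ^ 2 \<Rightarrow> real" where
  "chart_deriv c vs f = iter_deriv (\<lambda>y. sphere_eval f (inv_into (fst c) (snd c) y)) vs"

type_synonym deriv_test = "(real ^ 3, real ^ 2) chart \<times> (real ^ 2) set \<times> (real ^ 2) list"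

definition deriv_tests :: "deriv_test set set" where
  "deriv_tests = {I. finite I \<and>
     (\<forall>(c, K, vs)\<in>I. c \<in> sphere_atlas \<and> compact K \<and> K \<subseteq> snd c ` fst c)}"

definition deriv_nbhd :: "deriv_test set \<Rightarrow> real \<Rightarrow> sphere_fun set" where
  "deriv_nbhd I e = {h. \<forall>(c, K, vs)\<in>I. \<forall>y\<in>K. \<bar>chart_deriv c vs h y\<bar> < e}"

lemma deriv_tests_Un: "I \<in> deriv_tests \<Longrightarrow> J \<in> deriv_tests \<Longrightarrow> I \<union> J \<in> deriv_tests"
  by (auto simp: deriv_tests_def)

lemma deriv_nbhd_mono: "I \<subseteq> J \<Longrightarrow> e \<le> d \<Longrightarrow> deriv_nbhd J e \<subseteq> deriv_nbhd I d"
  by (fastforce simp: deriv_nbhd_def)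

lemma chart_deriv_add:
  assumes "c \<in> sphere_atlas" "y \<in> snd c ` fst c"
  shows "chart_deriv c vs (f + g) y = chart_deriv c vs f y + chart_deriv c vs g y"
  unfolding chart_deriv_def sphere_eval_add
  by (rule iter_deriv_add[OF smooth_on_sphere_eval smooth_on_sphere_eval]) (use assms in auto)

lemma chart_deriv_scaleR:
  assumes "c \<in> sphere_atlas" "y \<in> snd c ` fst c"
  shows "chart_deriv c vs (r *\<^sub>R f) y = r * chart_deriv c vs f y"
  unfolding chart_deriv_def sphere_eval_scaleR
  using iter_deriv_scaleR[OF smooth_on_sphere_eval, of "fst c" "snd c" y r f vs] assms by auto

lemma deriv_nbhd_add:
  assumes "I \<in> deriv_tests" "f \<in> deriv_nbhd I d" "g \<in> deriv_nbhd I e"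
  shows "f + g \<in> deriv_nbhd I (d + e)"
  unfolding deriv_nbhd_def
proof clarify
  fix U \<phi> K vs y assume i: "((U, \<phi>), K, vs) \<in> I" "y \<in> K"
  then have "chart_deriv (U, \<phi>) vs (f + g) y = chart_deriv (U, \<phi>) vs f y + chart_deriv (U, \<phi>) vs g y"
    using assms(1) by (intro chart_deriv_add) (fastforce simp: deriv_tests_def)+
  moreover have "\<bar>chart_deriv (U, \<phi>) vs f y\<bar> < d" "\<bar>chart_deriv (U, \<phi>) vs g y\<bar> < e"
    using assms(2,3) i by (fastforce simp: deriv_nbhd_def)+
  ultimately show "\<bar>chart_deriv (U, \<phi>) vs (f + g) y\<bar> < d + e"
    by linarith
qed

lemma deriv_nbhd_scaleR:
  assumes "I \<in> deriv_tests" "f \<in> deriv_nbhd I d" "\<bar>r\<bar> * d \<le> e" "0 < d" "0 < e"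
  shows "r *\<^sub>R f \<in> deriv_nbhd I e"
  unfolding deriv_nbhd_def
proof clarify
  fix U \<phi> K vs y assume i: "((U, \<phi>), K, vs) \<in> I" "y \<in> K"
  then have *: "chart_deriv (U, \<phi>) vs (r *\<^sub>R f) y = r * chart_deriv (U, \<phi>) vs f y"
    using assms(1) by (intro chart_deriv_scaleR) (fastforce simp: deriv_tests_def)+
  have f: "\<bar>chart_deriv (U, \<phi>) vs f y\<bar> < d"
    using assms(2) i by (fastforce simp: deriv_nbhd_def)
  show "\<bar>chart_deriv (U, \<phi>) vs (r *\<^sub>R f) y\<bar> < e"
  proof (cases "r = 0")
    case False
    then have "\<bar>r\<bar> * \<bar>chart_deriv (U, \<phi>) vs f y\<bar> < \<bar>r\<bar> * d"
      using f by (intro mult_strict_left_mono) auto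
    then show ?thesis
      using assms(3) by (simp add: * abs_mult)
  qed (use assms * in auto)
qed

lemma zero_in_deriv_nbhd:
  assumes "I \<in> deriv_tests" "0 < e"
  shows "0 \<in> deriv_nbhd I e"
  unfolding deriv_nbhd_def
proof clarify
  fix U \<phi> K vs y assume i: "((U, \<phi>), K, vs) \<in> I" "y \<in> K"
  then have "chart_deriv (U, \<phi>) vs (0 *\<^sub>R 0) y = 0 * chart_deriv (U, \<phi>) vs 0 y"
    using assms(1) by (intro chart_deriv_scaleR) (fastforce simp: deriv_tests_def)+
  then show "\<bar>chart_deriv (U, \<phi>) vs 0 y\<bar> < e"
    using assms by simp
qed

lemma deriv_nbhd_absorbing:
  assumes "I \<in> deriv_tests"
  obtains d where "0 < d" "f \<in> deriv_nbhd I d"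
proof -
  have "\<exists>d. \<forall>y\<in>K. \<bar>chart_deriv c vs f y\<bar> < d" if "(c, K, vs) \<in> I" for c K vs
  proof -
    have c: "c \<in> sphere_atlas" "compact K" "K \<subseteq> snd c ` fst c"
      using that assms by (auto simp: deriv_tests_def)
    have "continuous_on (snd c ` fst c) (chart_deriv c vs f)"
      unfolding chart_deriv_def
      by (rule smooth_on_continuous_iter1[OF smooth_on_sphere_eval]) (use c in simp)
    then have "compact (chart_deriv c vs f ` K)"
      using c by (intro compact_continuous_image) (auto intro: continuous_on_subset)
    then obtain b where "\<forall>z\<in>chart_deriv c vs f ` K. norm z \<le> b"
      by (meson bounded_iff compact_imp_bounded)
    then show ?thesis
      by (intro exI[of _ "b + 1"]) fastforce
  qed
  then have "\<forall>i\<in>I. \<exists>d. \<forall>y\<in>fst (snd i). \<bar>chart_deriv (fst i) (snd (snd i)) f y\<bar> < d"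
    by (metis prod.collapse)
  then obtain d where d: "\<forall>i\<in>I. \<forall>y\<in>fst (snd i). \<bar>chart_deriv (fst i) (snd (snd i)) f y\<bar> < d i"
    by metis
  define D where "D = Max (insert 1 (d ` I))"
  have fin: "finite I" using assms by (simp add: deriv_tests_def)
  have D2: "d i \<le> D" if "i \<in> I" for i
    unfolding D_def using fin that by (intro Max_ge) simp_all
  have "1 \<le> D"
    unfolding D_def using fin by (intro Max_ge) simp_all
  then have D1: "0 < D" by linarith
  have "f \<in> deriv_nbhd I D"
    unfolding deriv_nbhd_def using d D2 by force
  with D1 show ?thesis by (rule that)
qed

instantiation sphere_fun :: topological_space
begin

definition open_sphere_fun :: "sphere_fun set \<Rightarrow> bool" where
  "open_sphere_fun S \<longleftrightarrow>
     (\<forall>f\<in>S. \<exists>I\<in>deriv_tests. \<exists>e>0. \<forall>g. g - f \<in> deriv_nbhd I e \<longrightarrow> g \<in> S)"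

instance
proof
  show "open (UNIV :: sphere_fun set)"
    by (auto simp: open_sphere_fun_def deriv_tests_def intro!: exI[of _ "{}"] exI[of _ 1])
next
  fix S T :: "sphere_fun set" assume ST: "open S" "open T"
  show "open (S \<inter> T)"
    unfolding open_sphere_fun_def
  proof
    fix f assume "f \<in> S \<inter> T"
    then obtain I d J e where
      *: "I \<in> deriv_tests" "0 < d" "\<forall>g. g - f \<in> deriv_nbhd I d \<longrightarrow> g \<in> S"
      "J \<in> deriv_tests" "0 < e" "\<forall>g. g - f \<in> deriv_nbhd J e \<longrightarrow> g \<in> T"
      using ST unfolding open_sphere_fun_def by (metis IntE)
    have "deriv_nbhd (I \<union> J) (min d e) \<subseteq> deriv_nbhd I d"
      "deriv_nbhd (I \<union> J) (min d e) \<subseteq> deriv_nbhd J e"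
      by (intro deriv_nbhd_mono; auto)+
    with * show "\<exists>I\<in>deriv_tests. \<exists>e>0. \<forall>g. g - f \<in> deriv_nbhd I e \<longrightarrow> g \<in> S \<inter> T"
      by (intro bexI[of _ "I \<union> J"] exI[of _ "min d e"]) (auto intro: deriv_tests_Un)
  qed
next
  fix K :: "sphere_fun set set" assume "\<forall>S\<in>K. open S"
  then show "open (\<Union> K)"
    unfolding open_sphere_fun_def by (meson Union_iff)
qed

end

definition deriv_interior :: "sphere_fun set \<Rightarrow> sphere_fun set" where
  "deriv_interior S = {f. \<exists>I\<in>deriv_tests. \<exists>e>0. \<forall>g. g - f \<in> deriv_nbhd I e \<longrightarrow> g \<in> S}"

lemma deriv_interior_subset: "deriv_interior S \<subseteq> S"
proof
  fix f assume "f \<in> deriv_interior S"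
  then obtain I e where "I \<in> deriv_tests" "0 < e" "\<forall>g. g - f \<in> deriv_nbhd I e \<longrightarrow> g \<in> S"
    by (auto simp: deriv_interior_def)
  with zero_in_deriv_nbhd show "f \<in> S"
    by (metis diff_self)
qed

lemma open_deriv_interior: "open (deriv_interior S)"
  unfolding open_sphere_fun_def
proof
  fix f assume "f \<in> deriv_interior S"
  then obtain I e where I: "I \<in> deriv_tests" "0 < e" "\<forall>g. g - f \<in> deriv_nbhd I e \<longrightarrow> g \<in> S"
    by (auto simp: deriv_interior_def)
  have "g \<in> deriv_interior S" if "g - f \<in> deriv_nbhd I (e / 2)" for g
  proof -
    have "k \<in> S" if "k - g \<in> deriv_nbhd I (e / 2)" for k
      using deriv_nbhd_add[OF I(1) that \<open>g - f \<in> deriv_nbhd I (e / 2)\<close>] I(3) by simp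
    with I(1,2) show ?thesis
      unfolding deriv_interior_def by (auto intro!: bexI[of _ I] exI[of _ "e / 2"])
  qed
  with I(1,2) show "\<exists>I\<in>deriv_tests. \<exists>e>0. \<forall>g. g - f \<in> deriv_nbhd I e \<longrightarrow> g \<in> deriv_interior S"
    by (auto intro!: bexI[of _ I] exI[of _ "e / 2"])
qed

lemma eventually_nhds_sphere_fun:
  "eventually P (nhds f) \<longleftrightarrow>
    (\<exists>I\<in>deriv_tests. \<exists>e>0. \<forall>g. g - f \<in> deriv_nbhd I e \<longrightarrow> P g)"
proof
  assume "eventually P (nhds f)"
  then obtain S where "open S" "f \<in> S" "\<forall>g\<in>S. P g"
    by (auto simp: eventually_nhds)
  then show "\<exists>I\<in>deriv_tests. \<exists>e>0. \<forall>g. g - f \<in> deriv_nbhd I e \<longrightarrow> P g"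
    unfolding open_sphere_fun_def by meson
next
  assume "\<exists>I\<in>deriv_tests. \<exists>e>0. \<forall>g. g - f \<in> deriv_nbhd I e \<longrightarrow> P g"
  then have "f \<in> deriv_interior {g. P g}"
    by (simp add: deriv_interior_def)
  then show "eventually P (nhds f)"
    unfolding eventually_nhds using open_deriv_interior deriv_interior_subset by blast
qed

lemma tendsto_sphere_funI:
  assumes "\<And>I e. I \<in> deriv_tests \<Longrightarrow> 0 < e \<Longrightarrow> eventually (\<lambda>t. F t - f \<in> deriv_nbhd I e) G"
  shows "(F \<longlongrightarrow> f) G"
proof (rule filterlim_iff[THEN iffD2], intro allI impI)
  fix P assume "eventually P (nhds f)"
  then obtain I e where "I \<in> deriv_tests" "0 < e" "\<forall>g. g - f \<in> deriv_nbhd I e \<longrightarrow> P g"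
    by (auto simp: eventually_nhds_sphere_fun)
  with assms[of I e] show "eventually (\<lambda>t. P (F t)) G"
    by (auto elim: eventually_mono)
qed

lemma eventually_deriv_nbhd:
  assumes "I \<in> deriv_tests" "0 < e"
  shows "eventually (\<lambda>g. g - f \<in> deriv_nbhd I e) (nhds f)"
  using assms by (auto simp: eventually_nhds_sphere_fun)

lemma continuous_sphere_eval: "continuous_on UNIV (\<lambda>f. sphere_eval f x)"
proof (cases "x \<in> sphere 0 1")
  case True
  then obtain U \<phi> where c: "(U, \<phi>) \<in> sphere_atlas" "x \<in> U"
    using sphere_atlas_covers by (metis (no_types, lifting) UN_E prod.collapse)
  then have inj: "inj_on \<phi> U"
    by (auto simp: sphere_atlas_def submanifold_atlas_def)
  let ?I = "{((U, \<phi>), {\<phi> x}, [])}"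
  have I: "?I \<in> deriv_tests"
    using c by (auto simp: deriv_tests_def)
  have ev: "h \<in> deriv_nbhd ?I e \<longleftrightarrow> \<bar>sphere_eval h x\<bar> < e" for h e
    using inj c by (simp add: deriv_nbhd_def chart_deriv_def)
  have "((\<lambda>g. sphere_eval g x) \<longlongrightarrow> sphere_eval f x) (nhds f)" for f
  proof (rule tendstoI)
    fix e :: real assume "0 < e"
    from eventually_deriv_nbhd[OF I this, of f]
    show "\<forall>\<^sub>F g in nhds f. dist (sphere_eval g x) (sphere_eval f x) < e"
      unfolding ev
      by eventually_elim (simp add: sphere_eval_diff dist_real_def)
  qed
  then show ?thesis
    unfolding continuous_on_def by (meson at_within_le_nhds tendsto_mono)
next
  case False
  then have "sphere_eval f x = 0" for f
    using sphere_eval[of f] by auto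
  then show ?thesis by simp
qed

instance sphere_fun :: locally_convex_space
proof
  fix f g :: sphere_fun assume "f \<noteq> g"
  then obtain x where x: "sphere_eval f x \<noteq> sphere_eval g x"
    by (metis ext sphere_eval_inject)
  then obtain A B where AB: "open A" "open B" "sphere_eval f x \<in> A" "sphere_eval g x \<in> B" "A \<inter> B = {}"
    by (meson hausdorff)
  have "open ((\<lambda>f. sphere_eval f x) -` A)" "open ((\<lambda>f. sphere_eval f x) -` B)"
    using AB(1,2) continuous_sphere_eval by (auto intro: open_vimage)
  then show "\<exists>U V. open U \<and> open V \<and> f \<in> U \<and> g \<in> V \<and> U \<inter> V = {}"
    using AB(3-) by (intro exI[of _ "(\<lambda>f. sphere_eval f x) -` A"]
        exI[of _ "(\<lambda>f. sphere_eval f x) -` B"]) auto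
next
  fix a b :: sphere_fun
  show "((\<lambda>x. fst x + snd x) \<longlongrightarrow> a + b) (nhds a \<times>\<^sub>F nhds b)"
  proof (rule tendsto_sphere_funI)
    fix I and e :: real assume I: "I \<in> deriv_tests" "0 < e"
    have "eventually (\<lambda>x. fst x - a \<in> deriv_nbhd I (e / 2) \<and> snd x - b \<in> deriv_nbhd I (e / 2))
        (nhds a \<times>\<^sub>F nhds b)"
      using I by (intro eventually_conj eventually_compose_filterlim[OF _ filterlim_fst]
          eventually_compose_filterlim[OF _ filterlim_snd] eventually_deriv_nbhd) auto
    then show "eventually (\<lambda>x. fst x + snd x - (a + b) \<in> deriv_nbhd I e) (nhds a \<times>\<^sub>F nhds b)"
    proof eventually_elim
      case (elim x)
      then have "(fst x - a) + (snd x - b) \<in> deriv_nbhd I (e / 2 + e / 2)"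
        using I by (intro deriv_nbhd_add) auto
      then show ?case by (simp add: algebra_simps)
    qed
  qed
next
  fix a :: sphere_fun
  show "(uminus \<longlongrightarrow> - a) (nhds a)"
  proof (rule tendsto_sphere_funI)
    fix I and e :: real assume I: "I \<in> deriv_tests" "0 < e"
    from eventually_deriv_nbhd[OF this, of a]
    show "eventually (\<lambda>x. - x - - a \<in> deriv_nbhd I e) (nhds a)"
    proof eventually_elim
      case (elim x)
      then have "(-1) *\<^sub>R (x - a) \<in> deriv_nbhd I e"
        using I by (intro deriv_nbhd_scaleR[of I _ e]) auto
      then show ?case by (simp add: algebra_simps)
    qed
  qed
next
  fix r :: real and a :: sphere_fun
  show "((\<lambda>p. fst p *\<^sub>R snd p) \<longlongrightarrow> r *\<^sub>R a) (nhds r \<times>\<^sub>F nhds a)"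
  proof (rule tendsto_sphere_funI)
    fix I and e :: real assume I: "I \<in> deriv_tests" "0 < e"
    obtain d where d: "0 < d" "a \<in> deriv_nbhd I d"
      using deriv_nbhd_absorbing[OF I(1)] by blast
    define k where "k = min 1 (e / (2 * d))"
    have k: "0 < k" "k \<le> 1" "k * d \<le> e / 2"
      using d I by (auto simp: k_def min_def field_simps)
    define m where "m = e / (2 * (\<bar>r\<bar> + 1))"
    have m: "0 < m" "(\<bar>r\<bar> + 1) * m = e / 2"
      using I by (auto simp: m_def field_simps)
    have "eventually (\<lambda>p. dist (fst p) r < k \<and> snd p - a \<in> deriv_nbhd I m) (nhds r \<times>\<^sub>F nhds a)"
      using I k m by (intro eventually_conj eventually_compose_filterlim[OF _ filterlim_fst]
          eventually_compose_filterlim[OF _ filterlim_snd] eventually_deriv_nbhd)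
        (auto simp: eventually_nhds_metric)
    then show "eventually (\<lambda>p. fst p *\<^sub>R snd p - r *\<^sub>R a \<in> deriv_nbhd I e) (nhds r \<times>\<^sub>F nhds a)"
    proof eventually_elim
      case (elim p)
      then have p: "\<bar>fst p - r\<bar> \<le> k" by (simp add: dist_real_def)
      have "\<bar>fst p\<bar> * m \<le> (\<bar>r\<bar> + 1) * m"
        using p k m by (intro mult_right_mono) auto
      then have 1: "fst p *\<^sub>R (snd p - a) \<in> deriv_nbhd I (e / 2)"
        using elim I m by (intro deriv_nbhd_scaleR[of I _ m]) auto
      have "\<bar>fst p - r\<bar> * d \<le> k * d"
        using p d by (intro mult_right_mono) auto
      also note k(3)
      finally have 2: "(fst p - r) *\<^sub>R a \<in> deriv_nbhd I (e / 2)"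
        using d I by (intro deriv_nbhd_scaleR[of I a d]) auto
      from deriv_nbhd_add[OF I(1) 1 2] show ?case
        by (simp add: algebra_simps)
    qed
  qed
next
  fix U :: "sphere_fun set" assume "open U" "0 \<in> U"
  then obtain I e where I: "I \<in> deriv_tests" "0 < e" "\<forall>g. g - 0 \<in> deriv_nbhd I e \<longrightarrow> g \<in> U"
    unfolding open_sphere_fun_def by meson
  let ?N = "deriv_nbhd I e"
  have N: "u *\<^sub>R f + v *\<^sub>R g \<in> ?N"
    if "f \<in> ?N" "g \<in> ?N" "0 \<le> u" "0 \<le> v" "u + v = 1" for f g u v
  proof (cases "u = 0 \<or> v = 0")
    case True
    then show ?thesis using that by auto
  next
    case False
    then have "u *\<^sub>R f + v *\<^sub>R g \<in> deriv_nbhd I (u * e + v * e)"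
      using that I by (intro deriv_nbhd_add deriv_nbhd_scaleR[of I _ e]) auto
    moreover have "u * e + v * e = e"
      using that(5) by (simp add: distrib_right[symmetric])
    ultimately show ?thesis by simp
  qed
  have "u *\<^sub>R f + v *\<^sub>R g \<in> deriv_interior ?N"
    if fg: "f \<in> deriv_interior ?N" "g \<in> deriv_interior ?N"
      and uv: "0 \<le> u" "0 \<le> v" "u + v = 1" for f g u v
  proof -
    obtain J d where J: "J \<in> deriv_tests" "0 < d" "\<forall>k. k - f \<in> deriv_nbhd J d \<longrightarrow> k \<in> ?N"
      using fg(1) by (auto simp: deriv_interior_def)
    obtain J' d' where J': "J' \<in> deriv_tests" "0 < d'" "\<forall>k. k - g \<in> deriv_nbhd J' d' \<longrightarrow> k \<in> ?N"
      using fg(2) by (auto simp: deriv_interior_def)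
    have sub: "deriv_nbhd (J \<union> J') (min d d') \<subseteq> deriv_nbhd J d"
      "deriv_nbhd (J \<union> J') (min d d') \<subseteq> deriv_nbhd J' d'"
      by (intro deriv_nbhd_mono; auto)+
    have "k \<in> ?N" if k: "k - (u *\<^sub>R f + v *\<^sub>R g) \<in> deriv_nbhd (J \<union> J') (min d d')" for k
    proof -
      define n where "n = k - (u *\<^sub>R f + v *\<^sub>R g)"
      have n: "n \<in> deriv_nbhd (J \<union> J') (min d d')"
        using k by (simp add: n_def)
      have "f + n \<in> ?N"
        using J(3) sub(1) n by (metis add_diff_cancel_left' subsetD)
      moreover have "g + n \<in> ?N"
        using J'(3) sub(2) n by (metis add_diff_cancel_left' subsetD)
      ultimately have "u *\<^sub>R (f + n) + v *\<^sub>R (g + n) \<in> ?N"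
        using uv by (intro N) auto
      moreover have "u *\<^sub>R (f + n) + v *\<^sub>R (g + n) = u *\<^sub>R f + v *\<^sub>R g + (u + v) *\<^sub>R n"
        by (simp add: algebra_simps)
      ultimately show ?thesis
        using uv by (simp add: n_def)
    qed
    then show ?thesis
      unfolding deriv_interior_def using J J' deriv_tests_Un
      by (auto intro!: bexI[of _ "J \<union> J'"] exI[of _ "min d d'"])
  qed
  moreover have "0 \<in> deriv_interior ?N"
    using I by (auto simp: deriv_interior_def)
  moreover have "deriv_interior ?N \<subseteq> U"
    using deriv_interior_subset I(3) by fastforce
  ultimately show "\<exists>V. open V \<and> 0 \<in> V \<and> V \<subseteq> U \<and>
      (\<forall>x\<in>V. \<forall>y\<in>V. \<forall>u\<ge>0. \<forall>v\<ge>0. u + v = 1 \<longrightarrow> u *\<^sub>R x + v *\<^sub>R y \<in> V)"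
    using open_deriv_interior by (intro exI[of _ "deriv_interior ?N"]) blast
qed


section \<open>The Bondi--Metzner--Sachs group\<close>

text \<open>The index \<open>Inl 1\<close> is the time coordinate and \<open>Inr i\<close> are the space coordinates
  of \<open>\<real>\<^sup>1\<^sup>,\<^sup>3\<close>.\<close>

type_synonym mat13 = "real ^ (1 + 3) ^ (1 + 3)"

definition eta :: mat13 where
  "eta = (\<chi> i j. if i = j then (case i of Inl _ \<Rightarrow> 1 | Inr _ \<Rightarrow> -1) else 0)"

definition SO13 :: "mat13 set" where
  "SO13 = {g. transpose g ** eta ** g = eta \<and> det g = 1}"

definition SO13_0 :: "mat13 set" where
  "SO13_0 = connected_component_set SO13 (mat 1)"

definition block_a :: "mat13 \<Rightarrow> real" where
  "block_a g = g $ Inl 1 $ Inl 1"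

definition block_b :: "mat13 \<Rightarrow> real ^ 3" where
  "block_b g = (\<chi> j. g $ Inl 1 $ Inr j)"

definition block_c :: "mat13 \<Rightarrow> real ^ 3" where
  "block_c g = (\<chi> i. g $ Inr i $ Inl 1)"

definition block_m :: "mat13 \<Rightarrow> real ^ 3 ^ 3" where
  "block_m g = (\<chi> i j. g $ Inr i $ Inr j)"

definition conformal_factor :: "mat13 \<Rightarrow> real ^ 3 \<Rightarrow> real" where
  "conformal_factor g x = inverse (block_a g + block_b g \<bullet> x)"

definition sphere_action :: "mat13 \<Rightarrow> real ^ 3 \<Rightarrow> real ^ 3" where
  "sphere_action g x = inverse (block_a g + block_b g \<bullet> x) *\<^sub>R (block_c g + block_m g *v x)"

text \<open>With \<open>(\<sigma>\<^bsub>g\<^sup>-\<^sup>1\<^esub> f)(x) = J\<^sub>g(x) f(g.x)\<close>, the operator \<open>\<sigma>\<^sub>g\<close> involves the inverse of \<open>g\<close>.\<close>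

definition sigma :: "mat13 \<Rightarrow> sphere_fun \<Rightarrow> sphere_fun" where
  "sigma g f = Abs_sphere_fun (\<lambda>x. if x \<in> sphere 0 1
     then conformal_factor (matrix_inv g) x * sphere_eval f (sphere_action (matrix_inv g) x) else 0)"

definition SO13_0_group :: "mat13 monoid" where
  "SO13_0_group = \<lparr>carrier = SO13_0, mult = (**), one = mat 1\<rparr>"

definition SO13_0_atlas :: "(mat13, real ^ 6) atlas" where
  "SO13_0_atlas = submanifold_atlas SO13_0"

definition semidirect_product ::
    "('g \<Rightarrow> 'e::ab_group_add \<Rightarrow> 'e) \<Rightarrow> 'g monoid \<Rightarrow> ('e \<times> 'g) monoid" where
  "semidirect_product s G = \<lparr>carrier = UNIV \<times> carrier G,
     mult = (\<lambda>(v, g) (w, h). (v + s g w, g \<otimes>\<^bsub>G\<^esub> h)), one = (0, \<one>\<^bsub>G\<^esub>)\<rparr>"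

definition BMS :: "(sphere_fun \<times> mat13) monoid" where
  "BMS = semidirect_product sigma SO13_0_group"

definition BMS_atlas :: "(sphere_fun \<times> mat13, sphere_fun \<times> (real ^ 6)) atlas" where
  "BMS_atlas = prod_atlas model_atlas SO13_0_atlas"

end

theory Submission
  imports Defs
begin

text \<open>An exponential function is not injective near \<open>0\<close>. Let \<open>X\<close> generate the rotations about the
  third axis. In the semidirect product, \<open>exp (v, \<theta> X)\<close> has the translation part
  \<open>\<integral>\<^sub>0\<^sup>1 v \<circ> rot (- \<theta> s) ds\<close>. For \<open>v x = \<epsilon> Re ((x\<^sub>1 + \<i> x\<^sub>2) ^ n)\<close> and \<open>\<theta> = 2 \<pi> / n\<close> the
  integrand runs through a full period, so that \<open>exp (v, \<theta> X) = exp (0, \<theta> X)\<close>. Here \<open>n\<close> can be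
  arbitrarily large, and then \<open>\<epsilon> \<noteq> 0\<close> arbitrarily small.\<close>

section \<open>Derivatives of curves and one-parameter groups of matrices\<close>

text \<open>Translates between the limits of difference quotients in
  \<open>exponential_function\<close> and the library's derivatives, for which the chain and product
  rules are available.\<close>

lemma has_vector_derivative_at_iff_quotient:
  "(f has_vector_derivative l) (at x) \<longleftrightarrow> ((\<lambda>t. (f (x + t) - f x) /\<^sub>R t) \<longlongrightarrow> l) (at 0)"
proof -
  have "(f has_vector_derivative l) (at x) \<longleftrightarrow>
      ((\<lambda>h. norm (f (x + h) - f x - h *\<^sub>R l) / norm h) \<longlongrightarrow> 0) (at 0)"
    by (simp add: has_vector_derivative_def has_derivative_at bounded_linear_scaleR_left)
  also have "\<dots> \<longleftrightarrow> ((\<lambda>h. norm ((f (x + h) - f x) /\<^sub>R h - l)) \<longlongrightarrow> 0) (at 0)"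
  proof (intro tendsto_cong, unfold eventually_at_filter, intro always_eventually allI impI)
    fix h :: real assume h: "h \<noteq> 0"
    then have "(f (x + h) - f x) /\<^sub>R h - l = (f (x + h) - f x - h *\<^sub>R l) /\<^sub>R h"
      by (simp add: scaleR_diff_right)
    then show "norm (f (x + h) - f x - h *\<^sub>R l) / norm h = norm ((f (x + h) - f x) /\<^sub>R h - l)"
      by (simp add: divide_inverse mult.commute)
  qed
  also have "\<dots> \<longleftrightarrow> ((\<lambda>t. (f (x + t) - f x) /\<^sub>R t) \<longlongrightarrow> l) (at 0)"
    by (simp add: tendsto_norm_zero_iff LIM_zero_iff)
  finally show ?thesis .
qed

lemma bounded_bilinear_matrix_matrix_mult:
  "bounded_bilinear ((**) :: real ^ 'm ^ 'n \<Rightarrow> real ^ 'k ^ 'm \<Rightarrow> real ^ 'k ^ 'n)"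
  unfolding bilinear_conv_bounded_bilinear[symmetric] bilinear_def
  by (auto intro!: linearI simp: matrix_scalar_ac scalar_matrix_assoc[symmetric])
    (simp_all add: matrix_matrix_mult_def vec_eq_iff algebra_simps sum.distrib)

text \<open>The homomorphism law carries differentiability at \<open>0\<close> to every point, and
  \<open>G t ** H (- t)\<close> turns out to have derivative \<open>0\<close> everywhere, so it
  keeps its value \<open>mat 1\<close> at \<open>0\<close>. This identifies the Lorentz component of
  an exponential curve with a rotation.\<close>

lemma matrix_homomorphism_unique:
  fixes G H :: "real \<Rightarrow> real ^ 'n ^ 'n"
  assumes G: "\<And>s t. G (s + t) = G s ** G t" "G 0 = mat 1" "(G has_vector_derivative R) (at 0)"
    and H: "\<And>s t. H (s + t) = H s ** H t" "H 0 = mat 1" "(H has_vector_derivative R) (at 0)"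
  shows "G t = H t"
proof -
  interpret bounded_bilinear "(**) :: real ^ 'n ^ 'n \<Rightarrow> real ^ 'n ^ 'n \<Rightarrow> real ^ 'n ^ 'n"
    by (rule bounded_bilinear_matrix_matrix_mult)
  define K where "K = (\<lambda>t. G t ** H (- t))"
  have K: "(K has_vector_derivative 0) (at s)" for s
  proof -
    have G': "((\<lambda>h. G (h - s)) has_vector_derivative R) (at s)"
      using G(3) by (simp add: has_vector_derivative_at_iff_quotient)
    have H': "((\<lambda>h. H (s - h)) has_vector_derivative - R) (at s)"
      using vector_diff_chain_at[of "\<lambda>h. s - h" "-1" s H R] H(3)
      by (simp add: o_def has_real_derivative_iff_has_vector_derivative[symmetric]
          DERIV_cong[OF DERIV_diff[OF DERIV_const DERIV_ident]])
    \<comment> \<open>Splitting off the constant factors \<open>G s\<close> and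
      \<open>H (- s)\<close> leaves a product whose factors are both \<open>mat 1\<close> at
      \<open>h = s\<close>; there the product rule gives \<open>R - R = 0\<close>.\<close>
    have "K h = G s ** (G (h - s) ** H (s - h)) ** H (- s)" for h
      using G(1)[of s "h - s"] H(1)[of "s - h" "-s"] by (simp add: K_def matrix_mul_assoc)
    then have "K = (\<lambda>h. G s ** (G (h - s) ** H (s - h)) ** H (- s))" ..
    moreover have "((\<lambda>h. G (h - s) ** H (s - h)) has_vector_derivative 0) (at s)"
      using has_vector_derivative[OF G' H'] by (simp add: G(2) H(2) minus_right)
    then have "((\<lambda>h. G s ** (G (h - s) ** H (s - h)) ** H (- s)) has_vector_derivative 0) (at s)"
      using bounded_linear.has_vector_derivative[OF bounded_linear_left[of "H (- s)"]
          bounded_linear.has_vector_derivative[OF bounded_linear_right[of "G s"]]]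
      by (fastforce simp: zero_left zero_right)
    ultimately show ?thesis by simp
  qed
  have "K t = K 0"
  proof -
    have "\<exists>c. \<forall>x\<in>UNIV. K x = c"
      by (rule has_vector_derivative_zero_constant[of UNIV]) (use K in auto)
    then show ?thesis by auto
  qed
  then have "G t ** H (- t) = mat 1"
    by (simp add: K_def G(2) H(2))
  then have "G t ** (H (- t) ** H t) = H t"
    by (simp add: matrix_mul_assoc)
  then show ?thesis
    using H(1)[of "-t" t] H(2) by (metis add.left_inverse matrix_mul_rid)
qed

section \<open>Linear maps, smoothness and charts of submanifolds\<close>

text \<open>A continuous linear map commutes with limits of difference quotients, so the functions
  \<open>L (iter_deriv f (map w ks) x)\<close> form a family closed under differentiation.\<close>

lemma smooth_on_bounded_linear_compose:
  fixes f :: "'e::locally_convex_space \<Rightarrow> 'f::real_normed_vector"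
    and L :: "'f \<Rightarrow> 'g::real_normed_vector"
  assumes f: "smooth_on U f" and L: "bounded_linear L"
  shows "smooth_on U (\<lambda>x. L (f x))"
proof (rule smooth_onI_family)
  interpret bounded_linear L by fact
  let ?F = "\<lambda>(ks :: nat list) x w. L (iter_deriv f (map w ks) x)"
  show "open U" using f by (rule smooth_on_open)
  show "?F [] \<in> range ?F" by blast
  show "?F [] x w = L (f x)" for x w by simp
  fix F assume "F \<in> range ?F"
  then obtain ks where F: "F = ?F ks" by blast
  show "continuous_on (U \<times> UNIV) (\<lambda>(x, w). F x w)"
    unfolding F split_def using smooth_on_continuous_iter[OF f]
    by (intro continuous_on) (auto simp: split_def)
  have "has_dir_deriv (\<lambda>x. ?F ks x w) (?F (k # ks) x w) (w k) x" if "x \<in> U" for x w k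
    using tendsto[OF smooth_on_has_dir_deriv[OF f that, unfolded has_dir_deriv_def]]
    by (simp add: has_dir_deriv_def diff scaleR)
  then show "\<exists>G\<in>range ?F. \<forall>x\<in>U. \<forall>w. has_dir_deriv (\<lambda>x. F x w) (G x w) (w k) x" for k
    unfolding F by (intro bexI[OF _ rangeI[of ?F "k # ks"]]) auto
qed

text \<open>Provides the model vector \<open>X\<close> that represents a given tangent vector
  \<open>R\<close>. The atlas records \<open>\<phi>\<close> only as continuous, so
  \<open>\<phi> \<circ> \<gamma>\<close> cannot be differentiated directly; instead \<open>R\<close>
  is approximated by elements of \<open>range D\<close>, which is closed.\<close>

lemma submanifold_chart_velocity:
  fixes U :: "'a::euclidean_space set" and \<phi> :: "'a \<Rightarrow> 'e::euclidean_space"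
  assumes c: "(U, \<phi>) \<in> submanifold_atlas M"
    and \<gamma>: "(\<gamma> has_vector_derivative R) (at 0)" "range \<gamma> \<subseteq> M" "\<gamma> 0 \<in> U"
  obtains D X where "(inv_into U \<phi> has_derivative D) (at (\<phi> (\<gamma> 0)))" "D X = R"
proof -
  let ?i = "inv_into U \<phi>" and ?y = "\<phi> (\<gamma> 0)"
  have U: "openin (top_of_set M) U" and inj: "inj_on \<phi> U" and cont: "continuous_on U \<phi>"
    using c by (auto simp: submanifold_atlas_def)
  obtain D where D: "(?i has_derivative D) (at ?y)" "inj D"
    using c \<gamma>(3) by (auto simp: submanifold_atlas_def)
  have lin: "linear D"
    using D(1) by (simp add: has_derivative_linear)
  obtain B where B: "B > 0" "\<And>z. B * norm z \<le> norm (D z)"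
    using linear_inj_bounded_below_pos[OF lin D(2)] by metis
  have \<gamma>_lim: "(\<gamma> \<longlongrightarrow> \<gamma> 0) (at 0)"
    using has_vector_derivative_continuous[OF \<gamma>(1)] by (simp add: continuous_at)
  have evU: "eventually (\<lambda>t. \<gamma> t \<in> U) (at 0)"
  proof -
    obtain T where T: "open T" "U = M \<inter> T"
      using U by (auto simp: openin_open)
    show ?thesis
      using topological_tendstoD[OF \<gamma>_lim T(1)] \<gamma>(2,3) T(2)
      by (auto elim!: eventually_mono)
  qed
  have y_lim: "((\<lambda>t. \<phi> (\<gamma> t)) \<longlongrightarrow> ?y) (at 0)"
    using continuous_on_tendsto_compose[OF cont \<gamma>_lim \<gamma>(3) evU] .
  have quot: "((\<lambda>t. (\<gamma> t - \<gamma> 0) /\<^sub>R t) \<longlongrightarrow> R) (at 0)"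
    using \<gamma>(1) by (simp add: has_vector_derivative_at_iff_quotient)
  \<comment> \<open>Since \<open>D\<close> is bounded below, \<open>\<phi> (\<gamma> t) - \<phi> (\<gamma> 0) = O(t)\<close>, hence \<open>D ((\<phi> (\<gamma> t) - \<phi> (\<gamma> 0)) / t) \<longlongrightarrow> R\<close>.\<close>
  have "R \<in> closure (range D)"
    unfolding closure_approachable
  proof (intro allI impI)
    fix e :: real assume e: "0 < e"
    \<comment> \<open>The bound \<open>B / 2\<close> lets the linearization error
      \<open>d * norm z\<close> be absorbed into \<open>B * norm z\<close>, which yields
      \<open>norm z \<le> 2 / B * norm (\<gamma> t - \<gamma> 0)\<close>. The other bound then makes
      the error, divided by \<open>t\<close>, at most \<open>e / 2\<close>.\<close>
    define d where "d = min (B / 2) (e * B / (4 * (norm R + 1)))"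
    have np: "norm R + 1 > 0"
      by (simp add: add_nonneg_pos)
    have d: "0 < d" "d \<le> B / 2" "d * (norm R + 1) * 2 / B \<le> e / 2"
    proof -
      show "0 < d" using B e np by (simp add: d_def)
      show "d \<le> B / 2" unfolding d_def by (rule min.cobounded1)
      have "d * (4 * (norm R + 1)) \<le> e * B"
        using np mult_right_mono[OF min.cobounded2[of "B / 2" "e * B / (4 * (norm R + 1))"],
            of "4 * (norm R + 1)"]
        by (simp add: d_def)
      then show "d * (norm R + 1) * 2 / B \<le> e / 2"
        using B by (simp add: field_simps)
    qed
    obtain k where k: "k > 0"
      "\<And>y. norm (y - ?y) < k \<Longrightarrow> norm (?i y - ?i ?y - D (y - ?y)) \<le> d * norm (y - ?y)"
      using D(1) d(1) unfolding has_derivative_at_alt by blast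
    have "eventually (\<lambda>t. dist (\<phi> (\<gamma> t)) ?y < k) (at 0)"
      using y_lim k(1) by (rule tendstoD)
    moreover have "eventually (\<lambda>t. dist ((\<gamma> t - \<gamma> 0) /\<^sub>R t) R < min 1 (e / 2)) (at 0)"
      using quot e by (intro tendstoD) auto
    moreover have "eventually (\<lambda>t::real. t \<noteq> 0) (at 0)"
      by (simp add: eventually_at_filter)
    ultimately have "eventually (\<lambda>t. dist (\<phi> (\<gamma> t)) ?y < k \<and>
        dist ((\<gamma> t - \<gamma> 0) /\<^sub>R t) R < min 1 (e / 2) \<and> t \<noteq> 0 \<and> \<gamma> t \<in> U) (at 0)"
      using evU by eventually_elim auto
    then obtain t where t: "dist (\<phi> (\<gamma> t)) ?y < k" "dist ((\<gamma> t - \<gamma> 0) /\<^sub>R t) R < min 1 (e / 2)"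
      "t \<noteq> 0" "\<gamma> t \<in> U"
      using eventually_happens'[OF at_neq_bot] by blast
    define z where "z = \<phi> (\<gamma> t) - ?y"
    have i: "?i (\<phi> (\<gamma> t)) = \<gamma> t" "?i ?y = \<gamma> 0"
      using t(4) \<gamma>(3) inj by auto
    have err: "norm (\<gamma> t - \<gamma> 0 - D z) \<le> d * norm z"
      using k(2)[of "\<phi> (\<gamma> t)"] t(1) i by (simp add: z_def dist_norm)
    have "B * norm z \<le> norm (\<gamma> t - \<gamma> 0) + d * norm z"
      using B(2)[of z] err norm_triangle_sub[of "D z" "\<gamma> t - \<gamma> 0"]
      by (simp add: norm_minus_commute)
    moreover have "d * norm z \<le> B / 2 * norm z"
      using d(2) by (rule mult_right_mono) simp
    ultimately have z: "norm z \<le> 2 / B * norm (\<gamma> t - \<gamma> 0)"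
      using B(1) by (simp add: field_simps)
    have "norm ((\<gamma> t - \<gamma> 0) /\<^sub>R t) \<le> norm R + 1"
      using t(2) norm_triangle_sub[of "(\<gamma> t - \<gamma> 0) /\<^sub>R t" R] by (simp add: dist_norm)
    then have q: "norm (\<gamma> t - \<gamma> 0) / \<bar>t\<bar> \<le> norm R + 1"
      by (simp add: divide_inverse mult.commute)
    have "norm ((\<gamma> t - \<gamma> 0) /\<^sub>R t - D (z /\<^sub>R t)) = norm (\<gamma> t - \<gamma> 0 - D z) / \<bar>t\<bar>"
      by (simp add: linear_scale[OF lin] scaleR_diff_right[symmetric] divide_inverse mult.commute
          del: scaleR_diff_right)
    also have "\<dots> \<le> d * (2 / B * norm (\<gamma> t - \<gamma> 0)) / \<bar>t\<bar>"
      using err z d(1) by (intro divide_right_mono order_trans[OF err] mult_left_mono) auto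
    also have "\<dots> = d * 2 / B * (norm (\<gamma> t - \<gamma> 0) / \<bar>t\<bar>)"
      by simp
    also have "\<dots> \<le> d * 2 / B * (norm R + 1)"
      using q d(1) B(1) by (intro mult_left_mono) auto
    also have "\<dots> \<le> e / 2"
      using d(3) by (simp add: mult_ac)
    finally have "dist (D (z /\<^sub>R t)) ((\<gamma> t - \<gamma> 0) /\<^sub>R t) \<le> e / 2"
      by (simp add: dist_norm norm_minus_commute)
    then have "dist (D (z /\<^sub>R t)) R < e"
      using t(2) dist_triangle[of "D (z /\<^sub>R t)" R "(\<gamma> t - \<gamma> 0) /\<^sub>R t"] by linarith
    then show "\<exists>y\<in>range D. dist y R < e"
      by blast
  qed
  \<comment> \<open>A linear subspace of a finite-dimensional space is closed.\<close>
  then have "R \<in> range D"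
    using closed_subspace[OF linear_subspace_image[OF lin subspace_UNIV]] by (simp add: closure_closed)
  then show ?thesis
    using that D(1) by blast
qed

lemma submanifold_atlas_linear_image:
  fixes A B :: "'a::euclidean_space \<Rightarrow> 'a"
  assumes c: "(U, \<phi>) \<in> submanifold_atlas M"
    and lin: "linear A" "linear B" and AB: "\<And>x. A (B x) = x" "\<And>x. B (A x) = x" and M: "A ` M = M"
  shows "(A ` U, \<phi> \<circ> B) \<in> submanifold_atlas M"
    and "\<And>y. y \<in> \<phi> ` U \<Longrightarrow> inv_into (A ` U) (\<phi> \<circ> B) y = A (inv_into U \<phi> y)"
proof -
  have U: "openin (top_of_set M) U" and inj: "inj_on \<phi> U" and cont: "continuous_on U \<phi>"
    and sm: "smooth_on (\<phi> ` U) (inv_into U \<phi>)"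
    and der: "\<And>y. y \<in> \<phi> ` U \<Longrightarrow> \<exists>D. (inv_into U \<phi> has_derivative D) (at y) \<and> inj D"
    using c by (auto simp: submanifold_atlas_def)
  have bl: "bounded_linear A" "bounded_linear B"
    using lin by (simp_all add: linear_conv_bounded_linear)
  have im: "(\<phi> \<circ> B) ` A ` U = \<phi> ` U"
    by (simp add: image_image AB)
  have inj': "inj_on (\<phi> \<circ> B) (A ` U)"
    using inj by (auto simp: inj_on_def AB)
  show inv: "inv_into (A ` U) (\<phi> \<circ> B) y = A (inv_into U \<phi> y)" if "y \<in> \<phi> ` U" for y
    using that inj inj' by (intro inv_into_f_eq) (auto simp: AB inv_into_into f_inv_into_f)
  have op: "openin (top_of_set M) (A ` U)"
  proof -
    obtain T where T: "open T" "U = M \<inter> T"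
      using U by (auto simp: openin_open)
    have "open (B -` T)"
      using T(1) bl(2) by (intro open_vimage linear_continuous_on)
    moreover have "A ` U = M \<inter> B -` T"
      using M unfolding T(2) by (force simp: AB image_iff)
    ultimately show ?thesis
      by (auto simp: openin_open)
  qed
  have cont': "continuous_on (A ` U) (\<phi> \<circ> B)"
    by (rule continuous_on_compose[OF linear_continuous_on[OF bl(2)]]) (simp add: image_image AB cont)
  have op_im: "open (\<phi> ` U)"
    using sm by (rule smooth_on_open)
  have sm': "smooth_on (\<phi> ` U) (inv_into (A ` U) (\<phi> \<circ> B))"
    by (rule smooth_on_cong[OF smooth_on_bounded_linear_compose[OF sm bl(1)]]) (simp add: inv)
  have "\<exists>D. (inv_into (A ` U) (\<phi> \<circ> B) has_derivative D) (at y) \<and> inj D" if y: "y \<in> \<phi> ` U" for y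
  proof -
    obtain D where D: "(inv_into U \<phi> has_derivative D) (at y)" "inj D"
      using der[OF y] by blast
    have "((\<lambda>y. A (inv_into U \<phi> y)) has_derivative (\<lambda>h. A (D h))) (at y)"
      by (rule bounded_linear.has_derivative[OF bl(1) D(1)])
    then have "(inv_into (A ` U) (\<phi> \<circ> B) has_derivative (\<lambda>h. A (D h))) (at y)"
      using has_derivative_transform_within_open[OF _ op_im y] inv by metis
    moreover have "inj (\<lambda>h. A (D h))"
      using D(2) AB(2) by (metis (no_types, lifting) inj_def)
    ultimately show ?thesis by blast
  qed
  then show "(A ` U, \<phi> \<circ> B) \<in> submanifold_atlas M"
    unfolding submanifold_atlas_def mem_Collect_eq split im
    using op inj' cont' sm' by blast
qed

section \<open>Rotations about the third axis in the Lorentz group\<close>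

definition zrot :: "real \<Rightarrow> real ^ 3 ^ 3" where
  "zrot t = vector [vector [cos t, - sin t, 0], vector [sin t, cos t, 0], vector [0, 0, 1]]"

definition rot :: "real \<Rightarrow> mat13" where
  "rot t = (\<chi> i j. case i of
       Inl _ \<Rightarrow> (case j of Inl _ \<Rightarrow> 1 | Inr _ \<Rightarrow> 0)
     | Inr k \<Rightarrow> (case j of Inl _ \<Rightarrow> 0 | Inr l \<Rightarrow> zrot t $ k $ l))"

text \<open>This is the derivative of \<open>rot\<close> at \<open>0\<close>: the difference cancels
  the constant part of \<open>rot t\<close>, the \<open>cos\<close> part vanishes at
  \<open>pi / 2\<close> and \<open>- pi / 2\<close>, and the coefficient of \<open>sin t\<close>
  remains.\<close>

definition rot_gen :: mat13 where
  "rot_gen = (1 / 2) *\<^sub>R (rot (pi / 2) - rot (- pi / 2))"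

lemma zrot_nth:
  "zrot t $ 1 $ 1 = cos t" "zrot t $ 1 $ 2 = - sin t" "zrot t $ 1 $ 3 = 0"
  "zrot t $ 2 $ 1 = sin t" "zrot t $ 2 $ 2 = cos t" "zrot t $ 2 $ 3 = 0"
  "zrot t $ 3 $ 1 = 0" "zrot t $ 3 $ 2 = 0" "zrot t $ 3 $ 3 = 1"
  by (simp_all add: zrot_def)

lemma rot_nth:
  "rot t $ Inl i $ Inl j = 1" "rot t $ Inl i $ Inr l = 0"
  "rot t $ Inr k $ Inl j = 0" "rot t $ Inr k $ Inr l = zrot t $ k $ l"
  by (simp_all add: rot_def)

lemma zrot_mult_nth:
  "(zrot t *v x) $ 1 = cos t * x $ 1 - sin t * x $ 2"
  "(zrot t *v x) $ 2 = sin t * x $ 1 + cos t * x $ 2"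
  "(zrot t *v x) $ 3 = x $ 3"
  by (simp_all add: matrix_vector_mult_def sum_3 zrot_nth)

lemma zrot_mult_inverse: "zrot t *v (zrot (- t) *v x) = x" "zrot (- t) *v (zrot t *v x) = x"
proof -
  have cs: "cos t * (cos t * a) + sin t * (sin t * a) = a" for a
    by (simp add: mult.assoc[symmetric] distrib_right[symmetric])
  show "zrot t *v (zrot (- t) *v x) = x" "zrot (- t) *v (zrot t *v x) = x"
    by (simp_all add: vec_eq_iff forall_3 zrot_mult_nth algebra_simps cs)
qed

lemma zrot_0: "zrot 0 *v x = x"
  by (simp add: vec_eq_iff forall_3 zrot_mult_nth)

lemma norm_zrot_mult [simp]: "norm (zrot t *v x) = norm x"
proof -
  have "(cos t * a - sin t * b)\<^sup>2 + (sin t * a + cos t * b)\<^sup>2 = a\<^sup>2 + b\<^sup>2" for a b :: real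
    using sin_cos_squared_add[of t] by algebra
  then show ?thesis
    unfolding norm_eq inner_3 zrot_mult_nth by simp
qed

lemma zrot_image_sphere: "(*v) (zrot t) ` sphere 0 1 = sphere 0 1"
proof -
  have "x \<in> (*v) (zrot t) ` sphere 0 1" if "x \<in> sphere 0 1" for x
    using that zrot_mult_inverse(1)[of t x] by (intro image_eqI[of _ _ "zrot (- t) *v x"]) auto
  then show ?thesis by auto
qed

lemma sum_UNIV_1_plus_3: "(\<Sum>i\<in>UNIV. f i) = f (Inl 1) + f (Inr 1) + f (Inr 2) + f (Inr 3)"
  for f :: "1 + 3 \<Rightarrow> 'a::comm_monoid_add"
proof -
  have "(\<Sum>i\<in>UNIV. f i) = (\<Sum>i\<in>UNIV. f (Inl i)) + (\<Sum>i\<in>UNIV. f (Inr i))"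
    unfolding UNIV_Plus_UNIV[symmetric] by (simp add: sum.Plus o_def)
  then show ?thesis
    by (simp add: sum_3 UNIV_1 add.assoc)
qed

lemma rot_add: "rot (s + t) = rot s ** rot t"
  unfolding vec_eq_iff split_sum_all
  by (simp add: matrix_matrix_mult_def sum_UNIV_1_plus_3 rot_nth zrot_nth forall_3 cos_add sin_add)

lemma rot_0: "rot 0 = mat 1"
  unfolding vec_eq_iff split_sum_all
  by (simp add: rot_nth mat_def zrot_nth forall_3)

lemma transpose_rot: "transpose (rot t) = rot (- t)"
  unfolding vec_eq_iff split_sum_all
  by (simp add: rot_nth transpose_def zrot_nth forall_3)

lemma rot_mult_eta: "rot t ** eta = eta ** rot t"
  unfolding vec_eq_iff split_sum_all
  by (simp add: matrix_matrix_mult_def sum_UNIV_1_plus_3 rot_nth zrot_nth forall_3 eta_def)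

text \<open>With constant matrix coefficients, the derivative and the continuity of
  \<open>rot\<close> reduce to those of \<open>cos\<close> and \<open>sin\<close>.\<close>

lemma rot_eq_cos_sin:
  "rot t = (1 / 2) *\<^sub>R (rot 0 + rot pi) + cos t *\<^sub>R ((1 / 2) *\<^sub>R (rot 0 - rot pi)) + sin t *\<^sub>R rot_gen"
  unfolding vec_eq_iff split_sum_all
  by (simp add: rot_gen_def rot_nth zrot_nth forall_3)

lemma rot_has_vector_derivative: "(rot has_vector_derivative rot_gen) (at 0)"
proof -
  have "((\<lambda>t. (1 / 2) *\<^sub>R (rot 0 + rot pi) + cos t *\<^sub>R ((1 / 2) *\<^sub>R (rot 0 - rot pi)) + sin t *\<^sub>R rot_gen)
      has_vector_derivative rot_gen) (at 0)"
    by (auto intro!: derivative_eq_intros)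
  then show ?thesis
    unfolding rot_eq_cos_sin[symmetric] .
qed

lemma continuous_on_rot: "continuous_on S rot"
  by (subst rot_eq_cos_sin[abs_def]) (intro continuous_intros)

lemma rot_mult_inverse: "rot t ** rot (- t) = mat 1" "rot (- t) ** rot t = mat 1"
  using rot_add[of t "-t"] rot_add[of "-t" t] by (simp_all add: rot_0)

lemma det_rot: "det (rot t) = 1"
proof -
  \<comment> \<open>Orthogonality alone leaves the sign of the determinant open; since
    \<open>rot t\<close> is the square of the orthogonal matrix \<open>rot (t / 2)\<close>, the sign
    is positive.\<close>
  have "orthogonal_matrix (rot (t / 2))"
    by (simp add: orthogonal_matrix_def transpose_rot rot_mult_inverse)
  then have "det (rot (t / 2)) = 1 \<or> det (rot (t / 2)) = - 1"
    by (rule det_orthogonal_matrix)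
  moreover have "det (rot t) = det (rot (t / 2)) * det (rot (t / 2))"
    using rot_add[of "t / 2" "t / 2"] by (simp add: det_mul)
  ultimately show ?thesis by auto
qed

lemma rot_in_SO13: "rot t \<in> SO13"
proof -
  have "rot (- t) ** eta ** rot t = rot (- t) ** rot t ** eta"
    by (metis matrix_mul_assoc rot_mult_eta)
  then show ?thesis
    by (simp add: SO13_def transpose_rot det_rot rot_mult_inverse)
qed

lemma rot_in_SO13_0: "rot t \<in> SO13_0"
proof -
  have "connected (range rot)"
    by (intro connected_continuous_image continuous_on_rot connected_UNIV)
  moreover have "mat 1 \<in> range rot"
    by (metis rot_0 rangeI)
  ultimately have "range rot \<subseteq> SO13_0"
    unfolding SO13_0_def using rot_in_SO13 by (intro connected_component_maximal) auto
  then show ?thesis by blast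
qed

lemma matrix_inv_rot: "matrix_inv (rot t) = rot (- t)"
proof -
  have "\<exists>A. rot t ** A = mat 1 \<and> A ** rot t = mat 1"
    using rot_mult_inverse by blast
  then have "rot t ** matrix_inv (rot t) = mat 1"
    unfolding matrix_inv_def by (rule someI2_ex) simp
  then have "rot (- t) ** rot t ** matrix_inv (rot t) = rot (- t)"
    by (simp add: matrix_mul_assoc[symmetric])
  then show ?thesis by (simp add: rot_mult_inverse)
qed

section \<open>The action of rotations on functions on the sphere\<close>

lemma conformal_factor_rot: "conformal_factor (rot t) x = 1"
  by (simp add: conformal_factor_def block_a_def block_b_def rot_nth inner_vec_def)

lemma sphere_action_rot: "sphere_action (rot t) x = zrot t *v x"
  by (simp add: sphere_action_def block_a_def block_b_def block_c_def block_m_def rot_nth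
      inner_vec_def vec_eq_iff matrix_vector_mult_def)

text \<open>Since \<open>sigma\<close> is defined through \<open>Abs_sphere_fun\<close>, it can be
  evaluated only after the rotated function is known to be smooth. In a chart
  \<open>(U, \<phi>)\<close> the rotated function is \<open>f\<close> in the chart transported by
  the rotation, and every \<open>f\<close> is smooth in that chart too.\<close>

lemma sphere_eval_sigma_rot:
  assumes x: "x \<in> sphere 0 1"
  shows "sphere_eval (sigma (rot t) f) x = sphere_eval f (zrot (- t) *v x)"
proof -
  let ?A = "(*v) (zrot (- t))" and ?B = "(*v) (zrot t)"
  let ?g = "\<lambda>x. if x \<in> sphere 0 1 then sphere_eval f (?A x) else 0"
  have "smooth_on (\<phi> ` U) (?g \<circ> inv_into U \<phi>)" if c: "(U, \<phi>) \<in> sphere_atlas" for U \<phi>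
  proof -
    have lin: "linear ?A" "linear ?B"
      by simp_all
    note rotated = submanifold_atlas_linear_image[OF c[unfolded sphere_atlas_def] lin
        zrot_mult_inverse(2,1) zrot_image_sphere]
    have "smooth_on ((\<phi> \<circ> ?B) ` ?A ` U) (\<lambda>y. sphere_eval f (inv_into (?A ` U) (\<phi> \<circ> ?B) y))"
      using rotated(1) by (intro smooth_on_sphere_eval) (simp add: sphere_atlas_def)
    moreover have "(\<phi> \<circ> ?B) ` ?A ` U = \<phi> ` U"
      by (simp add: image_image zrot_mult_inverse)
    ultimately have "smooth_on (\<phi> ` U) (\<lambda>y. sphere_eval f (inv_into (?A ` U) (\<phi> \<circ> ?B) y))"
      by simp
    then show ?thesis
    proof (rule smooth_on_cong)
      fix y assume y: "y \<in> \<phi> ` U"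
      have "inv_into U \<phi> y \<in> sphere 0 1"
        using inv_into_into[OF y] sphere_chart_subset[OF c] by blast
      then show "sphere_eval f (inv_into (?A ` U) (\<phi> \<circ> ?B) y) = (?g \<circ> inv_into U \<phi>) y"
        using rotated(2)[OF y] by simp
    qed
  qed
  then have "?g \<in> {f. mfd_smooth_on sphere_atlas model_atlas (sphere 0 1) f \<and>
      (\<forall>x. x \<notin> sphere 0 1 \<longrightarrow> f x = 0)}"
    by (auto simp: mfd_smooth_on_sphere_iff)
  then have "sphere_eval (Abs_sphere_fun ?g) = ?g"
    by (rule Abs_sphere_fun_inverse)
  moreover have "sigma (rot t) f = Abs_sphere_fun ?g"
    by (simp add: sigma_def matrix_inv_rot conformal_factor_rot sphere_action_rot cong: if_cong)
  ultimately show ?thesis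
    using x by simp
qed

section \<open>Functions of rotational frequency n\<close>

text \<open>A sectoral spherical harmonic of degree \<open>n\<close>, up to scaling. The value
  \<open>0\<close> off the sphere is the convention of the type \<open>sphere_fun\<close>.\<close>

definition zpow :: "nat \<Rightarrow> sphere_fun" where
  "zpow n = Abs_sphere_fun
     (\<lambda>x. if x \<in> sphere 0 1 then Re (Complex (x $ 1) (x $ 2) ^ n) else 0)"

text \<open>Real and imaginary part are treated together because each of them for
  \<open>Suc n\<close> involves both of them for \<open>n\<close>.\<close>

lemma smooth_on_Re_Im_power:
  assumes "smooth_on U f" "smooth_on U g"
  shows "smooth_on U (\<lambda>x. Re (Complex (f x) (g x) ^ n)) \<and> smooth_on U (\<lambda>x. Im (Complex (f x) (g x) ^ n))"
proof (induction n)
  case 0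
  then show ?case
    using smooth_on_open[OF assms(1)] by (simp add: smooth_on_const)
next
  case (Suc n)
  have neg: "smooth_on U (\<lambda>x. - 1 * (g x * Im (Complex (f x) (g x) ^ n)))"
    using Suc smooth_on_open[OF assms(1)] by (intro smooth_on_mult smooth_on_const assms) auto
  have "smooth_on U (\<lambda>x. f x * Re (Complex (f x) (g x) ^ n) + - 1 * (g x * Im (Complex (f x) (g x) ^ n)))"
    using Suc by (intro smooth_on_add neg smooth_on_mult assms) auto
  moreover have "smooth_on U (\<lambda>x. f x * Im (Complex (f x) (g x) ^ n) + g x * Re (Complex (f x) (g x) ^ n))"
    using Suc by (intro smooth_on_add smooth_on_mult assms) auto
  ultimately show ?case by simp
qed

lemma sphere_eval_zpow:
  assumes "x \<in> sphere 0 1"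
  shows "sphere_eval (zpow n) x = Re (Complex (x $ 1) (x $ 2) ^ n)"
proof -
  let ?g = "\<lambda>x :: real ^ 3. if x \<in> sphere 0 1 then Re (Complex (x $ 1) (x $ 2) ^ n) else 0"
  have "smooth_on (\<phi> ` U) (?g \<circ> inv_into U \<phi>)" if c: "(U, \<phi>) \<in> sphere_atlas" for U \<phi>
  proof -
    have "smooth_on (\<phi> ` U) (inv_into U \<phi>)"
      using c by (auto simp: sphere_atlas_def submanifold_atlas_def)
    from smooth_on_bounded_linear_compose[OF this bounded_linear_vec_nth]
    have "smooth_on (\<phi> ` U) (\<lambda>y. Re (Complex (inv_into U \<phi> y $ 1) (inv_into U \<phi> y $ 2) ^ n))"
      by (intro smooth_on_Re_Im_power[THEN conjunct1])
    then show ?thesis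
    proof (rule smooth_on_cong)
      fix y assume y: "y \<in> \<phi> ` U"
      have "inv_into U \<phi> y \<in> sphere 0 1"
        using inv_into_into[OF y] sphere_chart_subset[OF c] by blast
      then show "Re (Complex (inv_into U \<phi> y $ 1) (inv_into U \<phi> y $ 2) ^ n) = (?g \<circ> inv_into U \<phi>) y"
        by simp
    qed
  qed
  then have "?g \<in> {f. mfd_smooth_on sphere_atlas model_atlas (sphere 0 1) f \<and>
      (\<forall>x. x \<notin> sphere 0 1 \<longrightarrow> f x = 0)}"
    by (auto simp: mfd_smooth_on_sphere_iff)
  then show ?thesis
    unfolding zpow_def using assms by (simp add: Abs_sphere_fun_inverse)
qed

lemma zpow_neq_0: "zpow n \<noteq> 0"
proof
  assume "zpow n = 0"
  moreover have "axis 1 1 \<in> sphere (0 :: real ^ 3) 1"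
    by (simp add: norm_axis_1)
  ultimately have "Re (Complex 1 0 ^ n) = 0"
    using sphere_eval_zpow[of "axis 1 1" n] by (simp add: sphere_eval_zero axis_def)
  then show False
    by (simp add: complex_of_real_def[symmetric] one_complex.code[symmetric])
qed

text \<open>Rotation by \<open>- t\<close> multiplies the complex coordinate by
  \<open>cis (- t)\<close>, hence its power by \<open>cis (- n * t)\<close>. So the value oscillates
  with period \<open>2 * pi / n\<close> in \<open>t\<close>.\<close>

lemma sphere_eval_zpow_zrot:
  assumes "x \<in> sphere 0 1"
  shows "sphere_eval (zpow n) (zrot (- t) *v x) =
    cos (n * t) * Re (Complex (x $ 1) (x $ 2) ^ n) + sin (n * t) * Im (Complex (x $ 1) (x $ 2) ^ n)"
proof -
  have "Complex ((zrot (- t) *v x) $ 1) ((zrot (- t) *v x) $ 2) = cis (- t) * Complex (x $ 1) (x $ 2)"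
    by (simp add: zrot_mult_nth complex_eq_iff)
  then have "sphere_eval (zpow n) (zrot (- t) *v x) = Re (cis (n * - t) * Complex (x $ 1) (x $ 2) ^ n)"
    using sphere_eval_zpow[of "zrot (- t) *v x" n] assms
    by (simp add: power_mult_distrib Complex.DeMoivre)
  then show ?thesis by simp
qed

section \<open>Exponential curves over the rotations\<close>

text \<open>The Lorentz component \<open>G\<close> of the curve is a homomorphism with velocity
  \<open>\<theta> *\<^sub>R rot_gen\<close>, hence a rotation. The translation component
  \<open>F\<close> is then a cocycle for this rotation; evaluating it at a point of the sphere gives
  a real differential equation, so that no integral in \<open>sphere_fun\<close> has to be
  formed.\<close>

lemma BMS_exponential_rotation:
  fixes ex :: "sphere_fun \<times> (real ^ 6) \<Rightarrow> sphere_fun \<times> mat13" and X :: "real ^ 6"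
  assumes c: "(U, \<phi>) \<in> SO13_0_atlas" "mat 1 \<in> U"
    and ex: "exponential_function BMS BMS_atlas (UNIV \<times> U, map_prod id \<phi>) ex"
    and D: "(inv_into U \<phi> has_derivative D) (at (\<phi> (mat 1)))" "D X = rot_gen"
  shows "snd (ex (t *\<^sub>R (v, \<theta> *\<^sub>R X))) = rot (\<theta> * t)"
    and "fst (ex 0) = 0"
    and "x \<in> sphere 0 1 \<Longrightarrow> ((\<lambda>t. sphere_eval (fst (ex (t *\<^sub>R (v, \<theta> *\<^sub>R X)))) x)
      has_real_derivative sphere_eval v (zrot (- (\<theta> * s)) *v x)) (at s)"
proof -
  define F where "F t = fst (ex (t *\<^sub>R (v, \<theta> *\<^sub>R X)))" for t
  define G where "G t = snd (ex (t *\<^sub>R (v, \<theta> *\<^sub>R X)))" for t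
  let ?\<gamma> = "\<lambda>t. ex (t *\<^sub>R (v, \<theta> *\<^sub>R X))"
  have \<gamma>: "?\<gamma> t = (F t, G t)" for t
    by (simp add: F_def G_def)
  have opg: "one_parameter_group BMS BMS_atlas ?\<gamma>"
    and lim: "((\<lambda>t. (map_prod id \<phi> (?\<gamma> t) - map_prod id \<phi> \<one>\<^bsub>BMS\<^esub>) /\<^sub>R t) \<longlongrightarrow> (v, \<theta> *\<^sub>R X)) (at 0)"
    using ex unfolding exponential_function_def snd_conv by blast+
  have one: "\<one>\<^bsub>BMS\<^esub> = (0, mat 1)"
    by (simp add: BMS_def semidirect_product_def SO13_0_group_def)
  have in_SO: "G t \<in> SO13_0" for t
  proof -
    have "range ?\<gamma> \<subseteq> carrier BMS"
      using opg by (simp add: one_parameter_group_def)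
    then have "(F t, G t) \<in> carrier BMS"
      unfolding \<gamma> by blast
    then show ?thesis
      by (simp add: BMS_def semidirect_product_def SO13_0_group_def)
  qed
  have add: "F (s + t) = F s + sigma (G s) (F t)" "G (s + t) = G s ** G t" for s t
  proof -
    have "?\<gamma> (s + t) = ?\<gamma> s \<otimes>\<^bsub>BMS\<^esub> ?\<gamma> t"
      using opg by (simp add: one_parameter_group_def)
    then show "F (s + t) = F s + sigma (G s) (F t)" "G (s + t) = G s ** G t"
      unfolding \<gamma> by (simp_all add: BMS_def semidirect_product_def SO13_0_group_def)
  qed
  have G0: "G 0 = mat 1"
  proof -
    \<comment> \<open>The law at \<open>s = t = 0\<close> makes \<open>G 0\<close> idempotent, and
      an invertible idempotent is the identity.\<close>
    have "det (G 0) = 1"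
      using in_SO[of 0] connected_component_subset[of SO13 "mat 1"]
      by (auto simp: SO13_0_def SO13_def)
    then obtain B where "B ** G 0 = mat 1"
      using invertible_det_nz[of "G 0"] by (auto simp: invertible_def)
    then show ?thesis
      using add(2)[of 0 0] by (metis add_0 matrix_mul_assoc matrix_mul_lid)
  qed
  have F0: "F 0 = 0"
  proof -
    \<comment> \<open>The cocycle law at \<open>s = t = 0\<close>, with the identity written as
      \<open>rot 0\<close> so that the formula for the action of rotations applies.\<close>
    have "sigma (rot 0) (F 0) = 0"
      using add(1)[of 0 0] G0 by (simp add: rot_0)
    then have "sphere_eval (F 0) x = sphere_eval 0 x" for x
      using sphere_eval_sigma_rot[of x 0 "F 0"] sphere_eval[of "F 0"] zrot_mult_inverse(1)[of 0 x]
      by (cases "x \<in> sphere 0 1") (auto simp: sphere_eval_zero zrot_0)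
    then show ?thesis
      by (metis ext sphere_eval_inject)
  qed
  then show "fst (ex 0) = 0"
    by (simp add: F_def zero_prod_def[symmetric])
  have "(UNIV \<times> U, map_prod id \<phi>) \<in> BMS_atlas"
    using c(1) by (auto simp: BMS_atlas_def prod_atlas_def model_atlas_def)
  moreover have "mfd_smooth_on model_atlas BMS_atlas UNIV ?\<gamma>"
    using opg by (simp add: one_parameter_group_def)
  \<comment> \<open>Smoothness in a chart includes openness of the domain, so \<open>G t\<close>
    stays in \<open>U\<close> for \<open>t\<close> near \<open>0\<close>.\<close>
  ultimately have "smooth_on (id ` {t \<in> UNIV \<inter> UNIV. ?\<gamma> t \<in> UNIV \<times> U})
      (map_prod id \<phi> \<circ> ?\<gamma> \<circ> inv_into UNIV id)"
    unfolding mfd_smooth_on_def model_atlas_def by blast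
  from smooth_on_open[OF this] have op: "open {t. G t \<in> U}"
    unfolding \<gamma> by simp
  have inj: "inj_on \<phi> U"
    using c(1) by (auto simp: SO13_0_atlas_def submanifold_atlas_def)
  \<comment> \<open>The prescribed velocity is known in the chart; applying the differentiable
    inverse of \<open>\<phi>\<close> with derivative \<open>D\<close> turns it into the velocity of
    \<open>G\<close> as a curve of matrices.\<close>
  have "((\<lambda>t. \<phi> (G t)) has_vector_derivative \<theta> *\<^sub>R X) (at 0)"
    using tendsto_snd[OF lim] unfolding has_vector_derivative_at_iff_quotient
    unfolding \<gamma> one by (simp add: G0)
  then have "(inv_into U \<phi> \<circ> (\<lambda>t. \<phi> (G t)) has_derivative D \<circ> (\<lambda>h. h *\<^sub>R \<theta> *\<^sub>R X)) (at 0)"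
    unfolding has_vector_derivative_def using D(1) by (intro diff_chain_at) (simp_all add: G0)
  moreover have "linear D"
    using D(1) by (rule has_derivative_linear)
  ultimately have "((\<lambda>t. inv_into U \<phi> (\<phi> (G t))) has_vector_derivative \<theta> *\<^sub>R rot_gen) (at 0)"
    by (simp add: has_vector_derivative_def o_def linear_scale D(2))
  then have G': "(G has_vector_derivative \<theta> *\<^sub>R rot_gen) (at 0)"
    by (rule has_vector_derivative_transform_within_open[OF _ op]) (use inj G0 c(2) in auto)
  have rot': "((\<lambda>t. rot (\<theta> * t)) has_vector_derivative \<theta> *\<^sub>R rot_gen) (at 0)"
  proof -
    have "((\<lambda>t. \<theta> * t) has_vector_derivative \<theta>) (at 0)"
      unfolding has_real_derivative_iff_has_vector_derivative[symmetric]
      by (auto intro!: derivative_eq_intros)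
    from vector_diff_chain_at[OF this, of rot rot_gen] rot_has_vector_derivative
    show ?thesis by (simp add: o_def)
  qed
  have G: "G t = rot (\<theta> * t)" for t
    by (rule matrix_homomorphism_unique[OF add(2) G0 G' _ _ rot'])
      (simp_all add: rot_add distrib_left rot_0)
  then show "snd (ex (t *\<^sub>R (v, \<theta> *\<^sub>R X))) = rot (\<theta> * t)"
    by (simp add: G_def)
  assume x: "x \<in> sphere 0 1"
  let ?y = "zrot (- (\<theta> * s)) *v x"
  have "((\<lambda>h. F h /\<^sub>R h) \<longlongrightarrow> v) (at 0)"
    using tendsto_fst[OF lim] unfolding \<gamma> one by simp
  from continuous_on_tendsto_compose[OF continuous_sphere_eval this]
  have "((\<lambda>h. sphere_eval (F h /\<^sub>R h) ?y) \<longlongrightarrow> sphere_eval v ?y) (at 0)"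
    by simp
  \<comment> \<open>By the cocycle law the increment at \<open>s\<close> is an increment at
    \<open>0\<close>, evaluated at the rotated point; the derivative at \<open>s\<close> thus comes
    from the velocity \<open>v\<close> at \<open>0\<close>.\<close>
  moreover have "sphere_eval (F (s + h)) x - sphere_eval (F s) x = sphere_eval (F h) ?y" for h
    using x by (simp add: add(1) G sphere_eval_add sphere_eval_sigma_rot)
  ultimately have "((\<lambda>t. sphere_eval (F t) x) has_real_derivative sphere_eval v ?y) (at s)"
    by (simp add: DERIV_def sphere_eval_scaleR divide_inverse mult.commute)
  then show "((\<lambda>t. sphere_eval (fst (ex (t *\<^sub>R (v, \<theta> *\<^sub>R X)))) x)
      has_real_derivative sphere_eval v ?y) (at s)"
    by (simp add: F_def)
qed

text \<open>Over the time interval from \<open>0\<close> to \<open>1\<close> the rotation angle runs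
  through one full period of \<open>zpow n\<close>, so the translation component returns to
  \<open>0\<close>. The resulting value does not depend on \<open>\<epsilon>\<close>.\<close>

lemma BMS_exponential_zpow:
  fixes ex :: "sphere_fun \<times> (real ^ 6) \<Rightarrow> sphere_fun \<times> mat13" and X :: "real ^ 6"
  assumes c: "(U, \<phi>) \<in> SO13_0_atlas" "mat 1 \<in> U"
    and ex: "exponential_function BMS BMS_atlas (UNIV \<times> U, map_prod id \<phi>) ex"
    and D: "(inv_into U \<phi> has_derivative D) (at (\<phi> (mat 1)))" "D X = rot_gen"
    and n: "n > 0"
  shows "ex (\<epsilon> *\<^sub>R zpow n, (2 * pi / n) *\<^sub>R X) = (0, rot (2 * pi / n))"
proof -
  define f where "f t x = sphere_eval (fst (ex (t *\<^sub>R (\<epsilon> *\<^sub>R zpow n, (2 * pi / n) *\<^sub>R X)))) x" for t x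
  have "f 1 x = 0" if x: "x \<in> sphere 0 1" for x
  proof -
    let ?w = "Complex (x $ 1) (x $ 2) ^ n"
    \<comment> \<open>An explicit antiderivative of the right-hand side of the differential
      equation. The frequency is \<open>n * (2 * pi / n) = 2 * pi\<close>, so \<open>g\<close> has
      period \<open>1\<close> and \<open>g 1 = g 0\<close>.\<close>
    define g where "g t = \<epsilon> / (2 * pi) * (sin (2 * pi * t) * Re ?w - cos (2 * pi * t) * Im ?w)" for t
    let ?d = "\<lambda>s. \<epsilon> * (cos (2 * pi * s) * Re ?w + sin (2 * pi * s) * Im ?w)"
    have "((\<lambda>t. f t x) has_real_derivative ?d s) (at s)" for s
      using BMS_exponential_rotation(3)[OF c ex D x, of "\<epsilon> *\<^sub>R zpow n" "2 * pi / n" s] n x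
      unfolding f_def[symmetric] sphere_eval_scaleR sphere_eval_zpow_zrot[OF x] by simp
    moreover have "(g has_real_derivative ?d s) (at s)" for s
      unfolding g_def by (rule derivative_eq_intros refl)+ (simp add: field_simps)
    ultimately have "((\<lambda>t. f t x - g t) has_real_derivative 0) (at s)" for s
      using DERIV_diff by fastforce
    then have "f 1 x - g 1 = f 0 x - g 0"
      by (intro DERIV_isconst_all) auto
    moreover have "f 0 x = 0"
      using BMS_exponential_rotation(2)[OF c ex D]
      by (simp add: f_def zero_prod_def[symmetric] sphere_eval_zero)
    ultimately show ?thesis
      by (simp add: g_def)
  qed
  moreover have "f 1 x = 0" if "x \<notin> sphere 0 1" for x
    using that sphere_eval by (auto simp: f_def)
  ultimately have "sphere_eval (fst (ex (\<epsilon> *\<^sub>R zpow n, (2 * pi / n) *\<^sub>R X))) = sphere_eval 0"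
    by (auto simp: f_def fun_eq_iff sphere_eval_zero)
  then have "fst (ex (\<epsilon> *\<^sub>R zpow n, (2 * pi / n) *\<^sub>R X)) = 0"
    by (simp add: sphere_eval_inject)
  moreover have "snd (ex (\<epsilon> *\<^sub>R zpow n, (2 * pi / n) *\<^sub>R X)) = rot (2 * pi / n)"
    using BMS_exponential_rotation(1)[OF c ex D, of 1 "\<epsilon> *\<^sub>R zpow n" "2 * pi / n"] by simp
  ultimately show ?thesis
    by (simp add: prod_eq_iff)
qed

section \<open>Failure of injectivity near zero\<close>

theorem theorem1:
  shows "\<not> locally_exponential BMS BMS_atlas"
proof
  assume "locally_exponential BMS BMS_atlas"
  then obtain c ex V W where c: "c \<in> BMS_atlas" "\<one>\<^bsub>BMS\<^esub> \<in> fst c"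
    and ex: "exponential_function BMS BMS_atlas c ex"
    and V: "open V" "0 \<in> V" and diffeo: "mfd_diffeo model_atlas BMS_atlas V W ex"
    unfolding locally_exponential_def by blast
  obtain U \<phi> where U: "c = (UNIV \<times> U, map_prod id \<phi>)" "(U, \<phi>) \<in> SO13_0_atlas"
    using c(1) by (auto simp: BMS_atlas_def prod_atlas_def model_atlas_def)
  have U1: "mat 1 \<in> U"
    using c(2) by (simp add: U BMS_def semidirect_product_def SO13_0_group_def)
  \<comment> \<open>\<open>X\<close> is the vector of the model space that represents the rotation
    generator in the chart, found from the curve \<open>rot\<close> in
    \<open>SO13_0\<close>.\<close>
  obtain D X where D: "(inv_into U \<phi> has_derivative D) (at (\<phi> (mat 1)))" "D X = rot_gen"
    using submanifold_chart_velocity[OF U(2)[unfolded SO13_0_atlas_def] rot_has_vector_derivative]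
      rot_in_SO13_0 U1 by (auto simp: rot_0)
  note exp = BMS_exponential_zpow[OF U(2) U1 ex[unfolded U] D]
  \<comment> \<open>The order of the choices matters: first the frequency is taken so large that the
    pure rotation vector lies in \<open>V\<close>, then for this fixed frequency the amplitude
    \<open>\<epsilon>\<close> is taken small. \<open>Suc\<close> keeps the frequency
    positive.\<close>
  have "(\<lambda>n. 2 * pi / real (Suc n)) \<longlonglongrightarrow> 0"
    by (intro tendsto_divide_0[OF tendsto_const] filterlim_at_top_imp_at_infinity
        filterlim_compose[OF filterlim_real_sequentially filterlim_Suc])
  then have "(\<lambda>n. (0 :: sphere_fun, (2 * pi / real (Suc n)) *\<^sub>R X)) \<longlonglongrightarrow> (0, 0 *\<^sub>R X)"
    by (intro tendsto_intros)
  from topological_tendstoD[OF this V(1)] V(2)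
  have "\<forall>\<^sub>F n in sequentially. (0, (2 * pi / real (Suc n)) *\<^sub>R X) \<in> V"
    by (simp add: zero_prod_def)
  then obtain m where m: "(0, (2 * pi / real (Suc m)) *\<^sub>R X) \<in> V"
    using eventually_happens'[OF sequentially_bot] by blast
  let ?n = "Suc m"
  let ?Y = "(2 * pi / real ?n) *\<^sub>R X"
  have "\<forall>\<^sub>F \<epsilon> in at 0. (0, ?Y) + \<epsilon> *\<^sub>R (zpow ?n, 0) \<in> V"
    by (rule eventually_line_in[OF V(1) m])
  moreover have "\<forall>\<^sub>F \<epsilon> :: real in at 0. \<epsilon> \<noteq> 0"
    by (simp add: eventually_at_filter)
  ultimately have "\<forall>\<^sub>F \<epsilon> in at 0. \<epsilon> \<noteq> 0 \<and> (\<epsilon> *\<^sub>R zpow ?n, ?Y) \<in> V"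
    by eventually_elim simp
  then obtain \<epsilon> where \<epsilon>: "\<epsilon> \<noteq> 0" "(\<epsilon> *\<^sub>R zpow ?n, ?Y) \<in> V"
    using eventually_happens'[OF at_neq_bot] by blast
  \<comment> \<open>Both sides equal \<open>(0, rot (2 * pi / ?n))\<close>, the right one by taking
    amplitude \<open>0\<close>.\<close>
  have "ex (\<epsilon> *\<^sub>R zpow ?n, ?Y) = ex (0, ?Y)"
    using exp[of ?n \<epsilon>] exp[of ?n 0] by simp
  moreover have "inj_on ex V"
    using diffeo by (simp add: mfd_diffeo_def bij_betw_def)
  ultimately have "\<epsilon> *\<^sub>R zpow ?n = 0"
    using \<epsilon>(2) m by (metis inj_onD prod.inject)
  then show False
    using \<epsilon>(1) zpow_neq_0 by simp
qed

end
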